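(* Let $K$ be an affine pyramid, let $k\ge 1$, let $s\in\{0,1,2,3\}$ and let $A\in\Theta^{(s)}(K)$ be a constant tensor field. Then for any $u,v\in\mathcal U^{(s)}_k(K)$ the quadrature scheme $S_{k,K}$ evaluates $(u,v)_{A,K}$ exactly, i.e. $$S_{k,K}\big(A^{ij}u_iv_j\big)=(u,v)_{A,K}=\int_K A^{ij}u_iv_j\,dx .$$
   Context: **Pyramids and coordinates.** The reference pyramid is $\hat K=\{(\xi,\eta,\zeta): 0\le\zeta\le1,\ 0\le\xi,\eta\le1-\zeta\}$. An affine pyramid $K\subset\mathbb R^3$ is the image of $\hat K$ under an affine bijection $\phi_K:\hat K\to K$; $|D\phi_K|$ is the absolute value of its Jacobian determinant. The infinite pyramid is $K_\infty=\{(x,y,z):0\le x,y\le1,\ 0\le z<\infty\}$, identified with $\hat K$ minus its apex $(0,0,1)$ by $\phi(x,y,z)=\big(\tfrac{x}{1+z},\tfrac{y}{1+z},\tfrac{z}{1+z}\big)$. **Forms and proxies.** $\Lambda^{(s)}(K)$ is the space of $s$-forms smooth in the interior of $K$, identified with scalar fields ($s=0,3$) or vector fields ($s=1$: $(u_1,u_2,u_3)$; $s=2$: $(u_{23},-u_{13},u_{12})$). The components of the proxy are $u_i$, $i\in\mathcal I_s=\{1,\dots,\binom3s\}$. The reference components $\hat u=(u_{\hat i})$ are the proxy of $\phi_K^*u$, and the infinite pyramid components $\tilde u=(u_{\tilde i})$ are the proxy of $(\phi_K\circ\phi)^*u$. A tensor field $A\in\Theta^{(s)}(K)$ is given by component functions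 $A^{ij}$, $i,j\in\mathcal I_s$, and $A(u,v)=A^{ij}u_iv_j$ (summation convention), $(u,v)_{A,K}=\int_KA^{ij}u_iv_j\,dx$. **Spaces.** $Q^{l,m,n}_k=\mathrm{span}\{x^ay^bz^c/(1+z)^k:0\le a\le l,0\le b\le m,0\le c\le n\}$ (equal to $\{0\}$ if $l$, $m$ or $n$ is negative); $Q^{l,m}[x,y]$ is the space of polynomials of degree $\le l$ in $x$ and $\le m$ in $y$. For $k\ge1$ put - $\overline{\mathcal U}^{(0)}_k=Q_k^{k,k,k-1}\oplus\mathrm{span}\{z^k/(1+z)^k\}$; - $\overline{\mathcal U}^{(1)}_k=Q_{k+1}^{k-1,k,k-1}\times Q_{k+1}^{k,k-1,k-1}\times Q_{k+1}^{k,k,k-2}\ \oplus\ \Big\{\frac{z^{k-1}}{(1+z)^{k+1}}(r_xz,\ r_yz,\ -r)^t: r\in Q^{k,k}[x,y]\Big\}$; - $\overline{\mathcal U}^{(2)}_k=Q_{k+2}^{k,k-1,k-2}\times Q_{k+2}^{k-1,k,k-2}\times Q_{k+2}^{k-1,k-1,k-1}\ \oplus\ \Big\{\frac{z^{k-1}}{(1+z)^{k+2}}(0,2s,s_y(1+z))^t: s\in Q^{k-1,k}[x,y]\Big\}\oplus\Big\{\frac{z^{k-1}}{(1+z)^{k+2}}(2t,0,t_x(1+z))^t: t\in Q^{k,k-1}[x,y]\Big\}$; - $\overline{\mathcal U}^{(3)}_k=Q_{k+3}^{k-1,k-1,k-1}$. (Subscripts $x,y$ on $r,s,t$ denote partial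 derivatives.) Let $\overline{\mathcal U}^{(s)}_k(K)=\{u\in\Lambda^{(s)}(K):\tilde u\in\overline{\mathcal U}^{(s)}_k\}$. The approximation space $\mathcal U^{(s)}_k(K)$ is the subspace of those $u\in\overline{\mathcal U}^{(s)}_k(K)$ whose trace on each triangular face of $K$ belongs to the trace space of the order-$k$ tetrahedral element: for $s=0$, the restriction to the face is a polynomial of degree $\le k$; for $s=1$, the tangential trace lies in the two-dimensional first-kind Nédélec space $(P^{k-1})^2\oplus\{p\in(\tilde P^k)^2: p\cdot t=0\}$ ($t$ = Cartesian coordinates on the face, $\tilde P^k$ = homogeneous polynomials of degree $k$); for $s=2$, the normal trace is a polynomial of degree $\le k-1$; for $s=3$ there is no condition. **Quadrature.** $S_{k,\hat K}(f)=\sum_{i,j,l}f\big(\xi_i(1-\zeta_l),\xi_j(1-\zeta_l),\zeta_l\big)\lambda_i\lambda_j\mu_l$, where $(\xi_i,\lambda_i)$ are the nodes and weights of the $(k+1)$-point Gauss–Legendre rule on $[0,1]$ (exact for $\int_0^1g(x)\,dx$ for all polynomials $g$ of degree $\le2k+1$), and $(\zeta_l,\mu_l)$ those of the $(k+1)$-point Gauss–Jacobi rule with weight $(1-z)^2$ on $[0,1]$ (exact for $\int_0^1(1-z)^2h(z)\,dz$ for all polynomials $h$ of degree $\le2k+1$). For a function $f$ on $K$, $S_{k,K}(f)=S_{k,\hat K}(|D\phi_K|\,f\circ\phi_K)$. *)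

theory Defs
  imports "HOL-Analysis.Analysis" "HOL-Computational_Algebra.Polynomial"
begin

section \<open>Pyramids\<close>

definition ref_pyramid :: "(real^3) set" where
  "ref_pyramid = {p. 0 \<le> p$3 \<and> p$3 \<le> 1 \<and> 0 \<le> p$1 \<and> p$1 \<le> 1 - p$3 \<and> 0 \<le> p$2 \<and> p$2 \<le> 1 - p$3}"

definition ref_apex :: "real^3" where
  "ref_apex = vector [0, 0, 1]"

definition inf_pyramid :: "(real^3) set" where
  "inf_pyramid = {p. 0 \<le> p$1 \<and> p$1 \<le> 1 \<and> 0 \<le> p$2 \<and> p$2 \<le> 1 \<and> 0 \<le> p$3}"

definition inf_map :: "real^3 \<Rightarrow> real^3" where
  "inf_map p = vector [p$1 / (1 + p$3), p$2 / (1 + p$3), p$3 / (1 + p$3)]"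

text \<open>The affine bijection of the reference pyramid onto \<open>K\<close> is given by its unique affine extension
  to the whole space, so that its derivative makes sense at boundary points as well.\<close>

definition affine_pyramid :: "(real^3 \<Rightarrow> real^3) \<Rightarrow> (real^3) set \<Rightarrow> bool" where
  "affine_pyramid \<phi>K K \<longleftrightarrow>
     (\<exists>L b. linear L \<and> \<phi>K = (\<lambda>x. L x + b)) \<and> bij_betw \<phi>K ref_pyramid K"

definition abs_jacobian :: "(real^3 \<Rightarrow> real^3) \<Rightarrow> real^3 \<Rightarrow> real" where
  "abs_jacobian F x = \<bar>det (matrix (frechet_derivative F (at x)))\<bar>"


section \<open>Differential forms and their proxies\<close>

text \<open>An alternating \<open>s\<close>-form at a point is a function of argument lists of length \<open>s\<close>;
  its values on lists of any other length carry no meaning.\<close>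

definition alternating_form :: "nat \<Rightarrow> ((real^3) list \<Rightarrow> real) \<Rightarrow> bool" where
  "alternating_form s \<alpha> \<longleftrightarrow>
     (\<forall>vs i. length vs = s \<longrightarrow> i < s \<longrightarrow> linear (\<lambda>v. \<alpha> (vs[i := v]))) \<and>
     (\<forall>vs i j. length vs = s \<longrightarrow> i < j \<longrightarrow> j < s \<longrightarrow> vs ! i = vs ! j \<longrightarrow> \<alpha> vs = 0)"

type_synonym form_field = "real^3 \<Rightarrow> (real^3) list \<Rightarrow> real"

primrec C_diff_on :: "nat \<Rightarrow> (real^3) set \<Rightarrow> (real^3 \<Rightarrow> real) \<Rightarrow> bool" where
  "C_diff_on 0 S f \<longleftrightarrow> continuous_on S f"
| "C_diff_on (Suc n) S f \<longleftrightarrow>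
     (\<forall>x\<in>S. f differentiable (at x)) \<and> (\<forall>v. C_diff_on n S (\<lambda>x. frechet_derivative f (at x) v))"

definition smooth_on :: "(real^3) set \<Rightarrow> (real^3 \<Rightarrow> real) \<Rightarrow> bool" where
  "smooth_on S f \<longleftrightarrow> (\<forall>n. C_diff_on n S f)"

definition smooth_forms :: "nat \<Rightarrow> (real^3) set \<Rightarrow> form_field set" where
  "smooth_forms s K = {\<omega>. (\<forall>x\<in>K. alternating_form s (\<omega> x)) \<and>
     (\<forall>vs. length vs = s \<longrightarrow> smooth_on (interior K) (\<lambda>x. \<omega> x vs))}"

definition pullback :: "(real^3 \<Rightarrow> real^3) \<Rightarrow> form_field \<Rightarrow> form_field" where
  "pullback F \<omega> = (\<lambda>x vs. \<omega> (F x) (map (frechet_derivative F (at x)) vs))"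

abbreviation e1 :: "real^3" where "e1 \<equiv> axis 1 1"
abbreviation e2 :: "real^3" where "e2 \<equiv> axis 2 1"
abbreviation e3 :: "real^3" where "e3 \<equiv> axis 3 1"

text \<open>The list of proxy components; it has length \<open>3 choose s\<close> for \<open>s \<le> 3\<close>.\<close>

definition proxy :: "nat \<Rightarrow> ((real^3) list \<Rightarrow> real) \<Rightarrow> real list" where
  "proxy s \<alpha> =
     (if s = 0 then [\<alpha> []]
      else if s = 1 then [\<alpha> [e1], \<alpha> [e2], \<alpha> [e3]]
      else if s = 2 then [\<alpha> [e2, e3], - \<alpha> [e1, e3], \<alpha> [e1, e2]]
      else [\<alpha> [e1, e2, e3]])"

definition comp_index :: "nat \<Rightarrow> nat set" where
  "comp_index s = {1..3 choose s}"

definition component :: "nat \<Rightarrow> form_field \<Rightarrow> nat \<Rightarrow> real^3 \<Rightarrow> real" where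
  "component s \<omega> i x = proxy s (\<omega> x) ! (i - 1)"

type_synonym tensor_field = "nat \<Rightarrow> nat \<Rightarrow> real^3 \<Rightarrow> real"

definition constant_tensor :: "nat \<Rightarrow> (real^3) set \<Rightarrow> tensor_field \<Rightarrow> bool" where
  "constant_tensor s K A \<longleftrightarrow> (\<forall>i\<in>comp_index s. \<forall>j\<in>comp_index s. A i j constant_on K)"

definition tensor_apply :: "nat \<Rightarrow> tensor_field \<Rightarrow> form_field \<Rightarrow> form_field \<Rightarrow> real^3 \<Rightarrow> real" where
  "tensor_apply s A u v x =
     (\<Sum>i\<in>comp_index s. \<Sum>j\<in>comp_index s. A i j x * component s u i x * component s v j x)"

definition tensor_inner ::
    "nat \<Rightarrow> tensor_field \<Rightarrow> (real^3) set \<Rightarrow> form_field \<Rightarrow> form_field \<Rightarrow> real" where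
  "tensor_inner s A K u v = (LINT x:K|lebesgue. tensor_apply s A u v x)"


section \<open>Spaces on the infinite pyramid\<close>

text \<open>The degree bounds are integers: a negative bound makes the sum empty and the space \<open>{0}\<close>.\<close>

definition Q3 :: "int \<Rightarrow> int \<Rightarrow> int \<Rightarrow> nat \<Rightarrow> (real^3 \<Rightarrow> real) set" where
  "Q3 l m n k = {f. \<exists>c. \<forall>p. f p =
     (\<Sum>a | int a \<le> l. \<Sum>b | int b \<le> m. \<Sum>d | int d \<le> n.
        c a b d * (p$1 ^ a * p$2 ^ b * p$3 ^ d / (1 + p$3) ^ k))}"

definition Q2 :: "nat \<Rightarrow> nat \<Rightarrow> (real \<Rightarrow> real \<Rightarrow> real) set" where
  "Q2 l m = {r. \<exists>c. \<forall>x y. r x y = (\<Sum>a\<le>l. \<Sum>b\<le>m. c a b * x ^ a * y ^ b)}"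

definition dx :: "(real \<Rightarrow> real \<Rightarrow> real) \<Rightarrow> real \<Rightarrow> real \<Rightarrow> real" where
  "dx r x y = deriv (\<lambda>t. r t y) x"

definition dy :: "(real \<Rightarrow> real \<Rightarrow> real) \<Rightarrow> real \<Rightarrow> real \<Rightarrow> real" where
  "dy r x y = deriv (\<lambda>t. r x t) y"

definition Ubar0 :: "nat \<Rightarrow> (real^3 \<Rightarrow> real list) set" where
  "Ubar0 k = {f. \<exists>q \<in> Q3 k k (int k - 1) k. \<exists>c.
     \<forall>p. f p = [q p + c * (p$3 ^ k / (1 + p$3) ^ k)]}"

definition Ubar1 :: "nat \<Rightarrow> (real^3 \<Rightarrow> real list) set" where
  "Ubar1 k = {f. \<exists>q1 \<in> Q3 (int k - 1) k (int k - 1) (k + 1).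
     \<exists>q2 \<in> Q3 k (int k - 1) (int k - 1) (k + 1).
     \<exists>q3 \<in> Q3 k k (int k - 2) (k + 1).
     \<exists>r \<in> Q2 k k.
     \<forall>p. let x = p$1; y = p$2; z = p$3; w = z ^ (k - 1) / (1 + z) ^ (k + 1) in
       f p = [q1 p + w * (dx r x y * z),
              q2 p + w * (dy r x y * z),
              q3 p + w * (- r x y)]}"

definition Ubar2 :: "nat \<Rightarrow> (real^3 \<Rightarrow> real list) set" where
  "Ubar2 k = {f. \<exists>q1 \<in> Q3 k (int k - 1) (int k - 2) (k + 2).
     \<exists>q2 \<in> Q3 (int k - 1) k (int k - 2) (k + 2).
     \<exists>q3 \<in> Q3 (int k - 1) (int k - 1) (int k - 1) (k + 2).
     \<exists>s \<in> Q2 (k - 1) k. \<exists>t \<in> Q2 k (k - 1).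
     \<forall>p. let x = p$1; y = p$2; z = p$3; w = z ^ (k - 1) / (1 + z) ^ (k + 2) in
       f p = [q1 p + w * (2 * t x y),
              q2 p + w * (2 * s x y),
              q3 p + w * (dy s x y * (1 + z)) + w * (dx t x y * (1 + z))]}"

definition Ubar3 :: "nat \<Rightarrow> (real^3 \<Rightarrow> real list) set" where
  "Ubar3 k = {f. \<exists>q \<in> Q3 (int k - 1) (int k - 1) (int k - 1) (k + 3). \<forall>p. f p = [q p]}"

definition Ubar :: "nat \<Rightarrow> nat \<Rightarrow> (real^3 \<Rightarrow> real list) set" where
  "Ubar s k = (if s = 0 then Ubar0 k else if s = 1 then Ubar1 k else if s = 2 then Ubar2 k else Ubar3 k)"


section \<open>Approximation spaces on an affine pyramid\<close>

definition Ubar_space :: "nat \<Rightarrow> nat \<Rightarrow> (real^3 \<Rightarrow> real^3) \<Rightarrow> (real^3) set \<Rightarrow> form_field set" where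
  "Ubar_space s k \<phi>K K = {u \<in> smooth_forms s K.
     \<exists>f \<in> Ubar s k. \<forall>p \<in> inf_pyramid. proxy s (pullback (\<phi>K \<circ> inf_map) u p) = f p}"

definition P2 :: "nat \<Rightarrow> (real \<Rightarrow> real \<Rightarrow> real) set" where
  "P2 n = {q. \<exists>c. \<forall>x y. q x y = (\<Sum>(a, b) \<in> {(a, b). a + b \<le> n}. c a b * x ^ a * y ^ b)}"

definition P2_hom :: "nat \<Rightarrow> (real \<Rightarrow> real \<Rightarrow> real) set" where
  "P2_hom n = {q. \<exists>c. \<forall>x y. q x y = (\<Sum>(a, b) \<in> {(a, b). a + b = n}. c a b * x ^ a * y ^ b)}"

definition nedelec2 :: "nat \<Rightarrow> ((real \<Rightarrow> real \<Rightarrow> real) \<times> (real \<Rightarrow> real \<Rightarrow> real)) set" where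
  "nedelec2 k = {(g1, g2). \<exists>q1 \<in> P2 (k - 1). \<exists>q2 \<in> P2 (k - 1). \<exists>p1 \<in> P2_hom k. \<exists>p2 \<in> P2_hom k.
     (\<forall>x y. p1 x y * x + p2 x y * y = 0) \<and>
     (\<forall>x y. g1 x y = q1 x y + p1 x y \<and> g2 x y = q2 x y + p2 x y)}"

definition triangular_face :: "(real^3) set \<Rightarrow> (real^3) set \<Rightarrow> bool" where
  "triangular_face F K \<longleftrightarrow> F face_of K \<and> 2 simplex F"

definition plane_point :: "real^3 \<Rightarrow> real^3 \<Rightarrow> real^3 \<Rightarrow> real \<Rightarrow> real \<Rightarrow> real^3" where
  "plane_point a d1 d2 x y = a + x *\<^sub>R d1 + y *\<^sub>R d2"

definition cartesian_coords :: "(real^3) set \<Rightarrow> real^3 \<Rightarrow> real^3 \<Rightarrow> real^3 \<Rightarrow> bool" where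
  "cartesian_coords F a d1 d2 \<longleftrightarrow> norm d1 = 1 \<and> norm d2 = 1 \<and> d1 \<bullet> d2 = 0 \<and>
     (\<forall>p\<in>F. \<exists>x y. p = plane_point a d1 d2 x y)"

text \<open>The trace is the form restricted to the face: in Cartesian coordinates with directions
  \<open>d1\<close>, \<open>d2\<close> it has the tangential components of the proxy if \<open>s = 1\<close>, and the component along
  the unit normal \<open>d1 \<times> d2\<close> if \<open>s = 2\<close>.  The apex, which the infinite pyramid does not reach, is left
  out: elements of the space need not be continuous there, and for \<open>s = 1, 2\<close> the traces on the four
  faces in general do not come from a single value at the apex.\<close>

definition trace_ok ::
    "nat \<Rightarrow> nat \<Rightarrow> form_field \<Rightarrow> (real^3) set \<Rightarrow> real^3 \<Rightarrow> real^3 \<Rightarrow> real^3 \<Rightarrow> bool" where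
  "trace_ok s k u F a d1 d2 \<longleftrightarrow>
     (s = 0 \<longrightarrow> (\<exists>q \<in> P2 k. \<forall>x y. plane_point a d1 d2 x y \<in> F \<longrightarrow>
        u (plane_point a d1 d2 x y) [] = q x y)) \<and>
     (s = 1 \<longrightarrow> (\<exists>(g1, g2) \<in> nedelec2 k. \<forall>x y. plane_point a d1 d2 x y \<in> F \<longrightarrow>
        u (plane_point a d1 d2 x y) [d1] = g1 x y \<and> u (plane_point a d1 d2 x y) [d2] = g2 x y)) \<and>
     (s = 2 \<longrightarrow> (\<exists>q \<in> P2 (k - 1). \<forall>x y. plane_point a d1 d2 x y \<in> F \<longrightarrow>
        u (plane_point a d1 d2 x y) [d1, d2] = q x y))"

text \<open>The trace spaces are invariant under a change of Cartesian coordinates on the face, so it does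
  not matter whether the condition is imposed for one or for all of them.\<close>

definition U_space :: "nat \<Rightarrow> nat \<Rightarrow> (real^3 \<Rightarrow> real^3) \<Rightarrow> (real^3) set \<Rightarrow> form_field set" where
  "U_space s k \<phi>K K = {u \<in> Ubar_space s k \<phi>K K.
     \<forall>F a d1 d2. triangular_face F K \<longrightarrow> cartesian_coords F a d1 d2 \<longrightarrow>
       trace_ok s k u (F - {\<phi>K ref_apex}) a d1 d2}"


section \<open>Quadrature\<close>

text \<open>The \<open>n\<close>-point Gauss rule on \<open>[0,1]\<close> for the weight function \<open>w\<close>: the rule with \<open>n\<close> nodes that is
  exact up to degree \<open>2n - 1\<close>.  This determines nodes and weights up to order.\<close>

definition gauss_rule :: "(real \<Rightarrow> real) \<Rightarrow> nat \<Rightarrow> (nat \<Rightarrow> real) \<Rightarrow> (nat \<Rightarrow> real) \<Rightarrow> bool" where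
  "gauss_rule w n x c \<longleftrightarrow> inj_on x {..<n} \<and> x ` {..<n} \<subseteq> {0..1} \<and>
     (\<forall>p :: real poly. degree p \<le> 2 * n - 1 \<longrightarrow>
        ((\<lambda>t. w t * poly p t) has_integral (\<Sum>i<n. poly p (x i) * c i)) {0..1})"

definition gauss_legendre :: "nat \<Rightarrow> (nat \<Rightarrow> real) \<Rightarrow> (nat \<Rightarrow> real) \<Rightarrow> bool" where
  "gauss_legendre = gauss_rule (\<lambda>_. 1)"

definition gauss_jacobi :: "nat \<Rightarrow> (nat \<Rightarrow> real) \<Rightarrow> (nat \<Rightarrow> real) \<Rightarrow> bool" where
  "gauss_jacobi = gauss_rule (\<lambda>z. (1 - z)\<^sup>2)"

definition quad_ref :: "nat \<Rightarrow> (nat \<Rightarrow> real) \<Rightarrow> (nat \<Rightarrow> real) \<Rightarrow> (nat \<Rightarrow> real) \<Rightarrow> (nat \<Rightarrow> real) \<Rightarrow>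
    (real^3 \<Rightarrow> real) \<Rightarrow> real" where
  "quad_ref k \<xi> lam \<zeta> mu f =
     (\<Sum>i<k+1. \<Sum>j<k+1. \<Sum>l<k+1.
        f (vector [\<xi> i * (1 - \<zeta> l), \<xi> j * (1 - \<zeta> l), \<zeta> l]) * lam i * lam j * mu l)"

definition quad :: "nat \<Rightarrow> (nat \<Rightarrow> real) \<Rightarrow> (nat \<Rightarrow> real) \<Rightarrow> (nat \<Rightarrow> real) \<Rightarrow> (nat \<Rightarrow> real) \<Rightarrow>
    (real^3 \<Rightarrow> real^3) \<Rightarrow> (real^3 \<Rightarrow> real) \<Rightarrow> real" where
  "quad k \<xi> lam \<zeta> mu \<phi>K f = quad_ref k \<xi> lam \<zeta> mu (\<lambda>x. abs_jacobian \<phi>K x * f (\<phi>K x))"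

end

theory Submission
  imports Defs
begin

text \<open>The idea is to collapse a cube onto the pyramid.  The map \<open>(x, y, \<zeta>) \<mapsto> (x (1 - \<zeta>), y (1 - \<zeta>), \<zeta>)\<close>
takes \<open>[0,1]\<^sup>2 \<times> [0,1)\<close> bijectively onto the reference pyramid without its apex, and its Jacobian
determinant \<open>(1 - \<zeta>)\<^sup>2\<close> is the weight of the Gauss-Jacobi rule.  The quadrature points are the images
of the tensor product Gauss points.  So both the integral over \<open>K\<close> and its quadrature are
\<open>\<bar>det L\<bar>\<close>, with \<open>L\<close> the linear part of the affine map, times the weighted integral over the cube and
the tensor product rule (\<open>pyramid_change_of_variables\<close>, \<open>quad_affine_pyramid\<close>), and these two agree
for integrands of degree at most \<open>2 k + 1\<close> in each of \<open>x\<close>, \<open>y\<close>, \<open>\<zeta>\<close> separately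
(\<open>cube_gauss_exact\<close>).

It therefore suffices that each component of \<open>u\<close> and \<open>v\<close> becomes a polynomial of degree at most \<open>k\<close>
in each variable on the cube (\<open>cube_poly_component\<close>): then a product of two components has degree at
most \<open>2 k\<close>, and so has a combination of such products with constant coefficients.  The infinite
pyramid has the coordinates \<open>x\<close>, \<open>y\<close>, \<open>z = \<zeta> / (1 - \<zeta>)\<close>, so that \<open>1 + z = 1 / (1 - \<zeta>)\<close> and
\<open>(1 + z)^e * z^d / (1 + z)^n = \<zeta>^d * (1 - \<zeta>)^(n - d - e)\<close>, which is a polynomial of degree \<open>n - e\<close>
in \<open>\<zeta>\<close> whenever \<open>d + e \<le> n\<close>.  The power \<open>(1+z)^e\<close> enters when the components on \<open>K\<close> are computed from those on the infinite pyramid: a constant vector, expressed in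
the frame transported from the infinite pyramid, has coordinates of the form \<open>(1+z) (c\<^sub>1 + c\<^sub>3 x)\<close>,
\<open>(1+z) (c\<^sub>2 + c\<^sub>3 y)\<close> and \<open>(1+z)\<^sup>2 c\<^sub>3\<close>.  The denominators \<open>(1+z)^(k+s)\<close> of the spaces absorb these
powers, and the factors \<open>x\<close> and \<open>y\<close> meet only components whose degree in that variable is
\<open>k - 1\<close>.\<close>


section \<open>Polynomials on the cube\<close>

text \<open>The face \<open>\<zeta> = 1\<close> is left out: it collapses to the apex, to which the infinite pyramid does not extend.\<close>

definition duffy_cube :: "(real^3) set" where
  "duffy_cube = {p. 0 \<le> p$1 \<and> p$1 \<le> 1 \<and> 0 \<le> p$2 \<and> p$2 \<le> 1 \<and> 0 \<le> p$3 \<and> p$3 < 1}"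

text \<open>Being a polynomial of degree at most \<open>l\<close>, \<open>m\<close>, \<open>n\<close> in the three variables, but only as far as the
values on the cube are concerned: composed with the map of the cube to \<open>K\<close>, the components of a form
are prescribed only there.  The inductive form reduces statements that are linear in the function
to monomials.\<close>

inductive cube_poly :: "nat \<Rightarrow> nat \<Rightarrow> nat \<Rightarrow> (real^3 \<Rightarrow> real) \<Rightarrow> bool" for l m n where
  monom: "a \<le> l \<Longrightarrow> b \<le> m \<Longrightarrow> c \<le> n \<Longrightarrow>
    (\<And>p. p \<in> duffy_cube \<Longrightarrow> f p = C * (p$1 ^ a * p$2 ^ b * p$3 ^ c)) \<Longrightarrow> cube_poly l m n f"
| add: "cube_poly l m n f \<Longrightarrow> cube_poly l m n g \<Longrightarrow>
    (\<And>p. p \<in> duffy_cube \<Longrightarrow> h p = f p + g p) \<Longrightarrow> cube_poly l m n h"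

lemma cube_poly_cong:
  assumes "cube_poly l m n f" "\<And>p. p \<in> duffy_cube \<Longrightarrow> g p = f p"
  shows "cube_poly l m n g"
  using assms(1) by (rule cube_poly.add[where g="\<lambda>_. 0"])
    (auto intro!: cube_poly.monom[where C=0] simp: assms)

lemma cube_poly_mono:
  assumes "cube_poly l m n f" "l \<le> l'" "m \<le> m'" "n \<le> n'"
  shows "cube_poly l' m' n' f"
  using assms(1)
proof induction
  case (monom a b c f C)
  then show ?case using assms(2-) by (intro cube_poly.monom[of a _ b _ c]) auto
next
  case (add f g h)
  then show ?case by (blast intro: cube_poly.add)
qed

lemma cube_poly_const: "cube_poly l m n (\<lambda>_. C)"
  by (rule cube_poly.monom[of 0 _ 0 _ 0]) auto

lemma cube_poly_x: "1 \<le> l \<Longrightarrow> cube_poly l m n (\<lambda>p. p$1)"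
  by (rule cube_poly.monom[of 1 _ 0 _ 0 _ _ 1]) auto

lemma cube_poly_y: "1 \<le> m \<Longrightarrow> cube_poly l m n (\<lambda>p. p$2)"
  by (rule cube_poly.monom[of 0 _ 1 _ 0 _ _ 1]) auto

lemma cube_poly_z: "1 \<le> n \<Longrightarrow> cube_poly l m n (\<lambda>p. p$3)"
  by (rule cube_poly.monom[of 0 _ 0 _ 1 _ _ 1]) auto

lemma cube_poly_add:
  "cube_poly l m n f \<Longrightarrow> cube_poly l m n g \<Longrightarrow> cube_poly l m n (\<lambda>p. f p + g p)"
  by (rule cube_poly.add) auto

lemma cube_poly_mult:
  assumes "cube_poly l m n f" "cube_poly l' m' n' g"
    and le: "l + l' \<le> L" "m + m' \<le> M" "n + n' \<le> N"
  shows "cube_poly L M N (\<lambda>p. f p * g p)"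
  using assms(1)
proof induction
  case (monom a b c f C)
  note f = this
  from assms(2) show ?case
  proof induction
    case (monom a' b' c' g C')
    with f le show ?case
      by (intro cube_poly.monom[of "a + a'" _ "b + b'" _ "c + c'" _ _ "C * C'"])
         (auto simp: power_add)
  next
    case (add g1 g2 g)
    show ?case
      by (rule cube_poly.add[OF add.IH]) (simp add: add.hyps algebra_simps)
  qed
next
  case (add f1 f2 f)
  show ?case
    by (rule cube_poly.add[OF add.IH]) (simp add: add.hyps algebra_simps)
qed

lemma cube_poly_cmult: "cube_poly l m n f \<Longrightarrow> cube_poly l m n (\<lambda>p. C * f p)"
  by (rule cube_poly_mult[OF cube_poly_const[where l=0 and m=0 and n=0]]) auto

lemma cube_poly_sum:
  "finite I \<Longrightarrow> (\<And>i. i \<in> I \<Longrightarrow> cube_poly l m n (f i)) \<Longrightarrow> cube_poly l m n (\<lambda>p. \<Sum>i\<in>I. f i p)"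
  by (induction I rule: finite_induct) (auto intro: cube_poly_const cube_poly_add)

lemma cube_poly_one_minus_z_power:
  assumes "e \<le> n" shows "cube_poly l m n (\<lambda>p. (1 - p$3) ^ e)"
proof -
  have "cube_poly 0 0 1 (\<lambda>p. 1 + (-1) * p$3)"
    by (intro cube_poly_add cube_poly_const cube_poly_cmult cube_poly_z) simp
  then have "cube_poly 0 0 1 (\<lambda>p. 1 - p$3)"
    by simp
  then have "cube_poly 0 0 e (\<lambda>p. (1 - p$3) ^ e)"
    by (induction e) (auto intro: cube_poly_const cube_poly_mult)
  then show ?thesis
    by (rule cube_poly_mono) (use assms in auto)
qed


section \<open>Gauss quadrature on the cube\<close>

text \<open>Tonelli's theorem for a product of nonnegative functions of one variable each.\<close>

lemma has_integral_cbox_prod: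
  fixes g :: "'n::finite \<Rightarrow> real \<Rightarrow> real"
  assumes cont: "\<And>i. continuous_on UNIV (g i)"
    and nonneg: "\<And>i t. t \<in> {0..1} \<Longrightarrow> 0 \<le> g i t"
    and int: "\<And>i. (g i has_integral I i) {0..1}"
  shows "((\<lambda>p :: real^'n. \<Prod>i\<in>UNIV. g i (p$i)) has_integral (\<Prod>i\<in>UNIV. I i)) (cbox 0 1)"
proof -
  have I_nonneg: "0 \<le> I i" for i
    using has_integral_nonneg[OF int] nonneg by blast
  have meas: "g i \<in> borel_measurable borel" for i
    using cont by (rule borel_measurable_continuous_onI)
  have meas': "(\<lambda>p :: real^'n. p $ i) \<in> borel_measurable borel" for i
    by (intro borel_measurable_continuous_onI continuous_intros)
  define h :: "real^'n \<Rightarrow> real \<Rightarrow> ennreal"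
    where "h b t = ennreal (g (axis_index b) t) * indicator {0..1} t" for b t
  have prod_Basis: "(\<Prod>b\<in>Basis. F b) = (\<Prod>i\<in>UNIV. F (axis i 1))" for F :: "real^'n \<Rightarrow> ennreal"
    by (simp add: Basis_vec_def UNION_singleton_eq_range prod.reindex axis_eq_axis inj_on_def)
  have axis_index: "axis_index (axis i 1 :: real^'n) = i" for i
    by simp
  have "(\<integral>\<^sup>+p. ennreal (\<Prod>i\<in>UNIV. g i (p$i)) * indicator (cbox 0 1) p \<partial>lborel)
      = (\<integral>\<^sup>+p. (\<Prod>b\<in>Basis. h b (p \<bullet> b)) \<partial>lborel)"
  proof (rule nn_integral_cong)
    fix p :: "real^'n"
    show "ennreal (\<Prod>i\<in>UNIV. g i (p$i)) * indicator (cbox 0 1) p = (\<Prod>b\<in>Basis. h b (p \<bullet> b))"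
    proof (cases "p \<in> cbox 0 1")
      case True
      then have "p $ i \<in> {0..1}" for i
        by (simp add: mem_box_cart)
      then show ?thesis
        using True nonneg
        by (simp add: prod_Basis h_def axis_index inner_axis prod_ennreal)
    next
      case False
      then obtain i where "p $ i \<notin> {0..1}"
        by (auto simp: mem_box_cart)
      then have "h (axis i 1) (p \<bullet> axis i 1) = 0"
        by (simp add: h_def inner_axis)
      then have "(\<Prod>i\<in>UNIV. h (axis i 1) (p \<bullet> axis i 1)) = 0"
        by (intro prod_zero) auto
      then show ?thesis
        using False by (simp add: prod_Basis)
    qed
  qed
  also have "\<dots> = (\<Prod>b\<in>Basis. (\<integral>\<^sup>+t. h b t \<partial>lborel))"
    using meas unfolding h_def by (intro nn_integral_lborel_prod) auto
  also have "\<dots> = (\<Prod>i\<in>UNIV. ennreal (I i))"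
    using nn_integral_has_integral_lebesgue'[OF nonneg int]
    by (simp add: prod_Basis h_def axis_index)
  also have "\<dots> = ennreal (\<Prod>i\<in>UNIV. I i)"
    using I_nonneg by (simp add: prod_ennreal)
  finally have nn: "(\<integral>\<^sup>+p. ennreal (\<Prod>i\<in>UNIV. g i (p$i)) * indicator (cbox 0 1) p \<partial>lborel)
    = ennreal (\<Prod>i\<in>UNIV. I i)" .
  have "((\<lambda>p. (\<Prod>i\<in>UNIV. g i (p$i)) * indicator (cbox 0 1) p) has_integral (\<Prod>i\<in>UNIV. I i)) UNIV"
  proof (rule nn_integral_has_integral)
    show "(\<lambda>p :: real^'n. (\<Prod>i\<in>UNIV. g i (p$i)) * indicator (cbox 0 1) p) \<in> borel_measurable borel"
      using meas meas' by (intro borel_measurable_times borel_measurable_prod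
          measurable_compose[OF meas' meas] borel_measurable_indicator) auto
    show "0 \<le> (\<Prod>i\<in>UNIV. g i (p$i)) * indicator (cbox 0 1) p" for p :: "real^'n"
      by (cases "p \<in> cbox 0 1") (auto intro!: prod_nonneg nonneg simp: mem_box_cart)
    show "0 \<le> (\<Prod>i\<in>UNIV. I i)"
      using I_nonneg by (simp add: prod_nonneg)
    show "(\<integral>\<^sup>+p. ennreal ((\<Prod>i\<in>UNIV. g i (p$i)) * indicator (cbox 0 1) p) \<partial>lborel)
      = ennreal (\<Prod>i\<in>UNIV. I i)"
      unfolding nn[symmetric] by (intro nn_integral_cong) (auto simp: indicator_def)
  qed
  moreover have "(\<lambda>p. (\<Prod>i\<in>UNIV. g i (p$i)) * indicator (cbox 0 1) p)
      = (\<lambda>p :: real^'n. if p \<in> cbox 0 1 then \<Prod>i\<in>UNIV. g i (p$i) else 0)"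
    by (auto simp: indicator_def)
  ultimately show ?thesis
    by (simp only: has_integral_restrict_UNIV)
qed

text \<open>No node lies at the apex, where the fields have no prescribed values.  If \<open>1\<close> were the node \<open>x i\<close>,
then \<open>(1 - t)\<close> times the squares of the \<open>t - x j\<close> for the other nodes would vanish at all nodes and have
degree \<open>2 n - 1\<close>, so that exactness would give integral zero to a nonnegative polynomial other than zero.\<close>

lemma gauss_jacobi_nodes_less_1:
  assumes "gauss_jacobi n x c" "i < n"
  shows "x i < 1"
proof (rule ccontr)
  assume "\<not> x i < 1"
  moreover have range: "x ` {..<n} \<subseteq> {0..1}"
    using assms(1) by (simp add: gauss_jacobi_def gauss_rule_def)
  ultimately have xi: "x i = 1"
    using assms(2) by force
  define p :: "real poly" where "p = [:1, -1:] * (\<Prod>j\<in>{..<n} - {i}. [:- x j, 1:] ^ 2)"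
  have poly_p: "poly p t = (1 - t) * (\<Prod>j\<in>{..<n} - {i}. (t - x j)\<^sup>2)" for t
    by (simp add: p_def poly_prod algebra_simps)
  have "degree p \<le> 1 + (\<Sum>j\<in>{..<n} - {i}. 2)"
    unfolding p_def
    by (intro order_trans[OF degree_mult_le] add_mono order_trans[OF degree_prod_sum_le] sum_mono)
       (auto intro!: order_trans[OF degree_power_le])
  then have deg: "degree p \<le> 2 * n - 1"
    using assms(2) by simp
  have "poly p (x j) = 0" if "j < n" for j
    using that by (cases "j = i") (auto simp: poly_p xi intro!: prod_zero)
  then have "(\<Sum>j<n. poly p (x j) * c j) = 0"
    by (intro sum.neutral) auto
  then have "((\<lambda>t. (1 - t)\<^sup>2 * poly p t) has_integral 0) (cbox 0 1)"
    using assms(1) deg unfolding gauss_jacobi_def gauss_rule_def by fastforce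
  then have zero: "(1 - t)\<^sup>2 * poly p t = 0" if "t \<in> cbox 0 1" for t
    by (rule has_integral_0_cbox_imp_0[rotated 2])
       (use that in \<open>auto intro!: continuous_intros mult_nonneg_nonneg prod_nonneg simp: poly_p\<close>)
  have "{0<..<1} \<subseteq> {t. poly p t = 0}"
  proof
    fix t :: real assume "t \<in> {0<..<1}"
    then show "t \<in> {t. poly p t = 0}"
      using zero[of t] by auto
  qed
  moreover have "finite {t. poly p t = 0}"
    by (rule poly_roots_finite) (simp add: p_def del: mult_pCons_left)
  ultimately show False
    by (meson finite_subset infinite_Ioo zero_less_one)
qed

definition cube_quad ::
    "nat \<Rightarrow> (nat \<Rightarrow> real) \<Rightarrow> (nat \<Rightarrow> real) \<Rightarrow> (nat \<Rightarrow> real) \<Rightarrow> (nat \<Rightarrow> real) \<Rightarrow> (real^3 \<Rightarrow> real) \<Rightarrow> real"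
  where "cube_quad k \<xi> lam \<zeta> mu f =
    (\<Sum>i<k+1. \<Sum>j<k+1. \<Sum>l<k+1. f (vector [\<xi> i, \<xi> j, \<zeta> l]) * lam i * lam j * mu l)"

lemma gauss_nodes_in_duffy_cube:
  assumes "gauss_legendre n \<xi> lam" "gauss_jacobi n \<zeta> mu" "i < n" "j < n" "l < n"
  shows "vector [\<xi> i, \<xi> j, \<zeta> l] \<in> duffy_cube"
proof -
  have "\<xi> ` {..<n} \<subseteq> {0..1}" "\<zeta> ` {..<n} \<subseteq> {0..1}"
    using assms by (simp_all add: gauss_legendre_def gauss_jacobi_def gauss_rule_def)
  then have "\<xi> i \<in> {0..1}" "\<xi> j \<in> {0..1}" "\<zeta> l \<in> {0..1}"
    using assms by auto
  then show ?thesis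
    using gauss_jacobi_nodes_less_1[OF assms(2,5)] by (simp add: duffy_cube_def)
qed

lemma cube_quad_cong:
  assumes "gauss_legendre (k + 1) \<xi> lam" "gauss_jacobi (k + 1) \<zeta> mu"
    and "\<And>p. p \<in> duffy_cube \<Longrightarrow> f p = g p"
  shows "cube_quad k \<xi> lam \<zeta> mu f = cube_quad k \<xi> lam \<zeta> mu g"
  unfolding cube_quad_def
  by (intro sum.cong refl) (use gauss_nodes_in_duffy_cube[OF assms(1,2)] assms(3) in simp)

lemma duffy_cube_eq_cbox_minus: "duffy_cube = cbox 0 1 - {p. p$3 = 1}"
  by (auto simp: duffy_cube_def mem_box_cart forall_3)

lemma negligible_top: "negligible {p :: real^3. p$3 = 1}"
  using negligible_standard_hyperplane[of "axis 3 1 :: real^3" 1]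
  by (simp add: cart_eq_inner_axis axis_in_Basis_iff)

text \<open>For a monomial both sides factor into one-dimensional integrals and one-dimensional rules; the
weight \<open>(1 - \<zeta>)\<^sup>2\<close> goes to the factor of the third variable.\<close>

lemma cube_gauss_exact:
  assumes legendre: "gauss_legendre (k + 1) \<xi> lam" and jacobi: "gauss_jacobi (k + 1) \<zeta> mu"
    and "cube_poly (2 * k + 1) (2 * k + 1) (2 * k + 1) f"
  shows "(\<lambda>p. (1 - p$3)\<^sup>2 * f p) absolutely_integrable_on duffy_cube \<and>
    ((\<lambda>p. (1 - p$3)\<^sup>2 * f p) has_integral cube_quad k \<xi> lam \<zeta> mu f) duffy_cube"
  using assms(3)
proof induction
  case (monom a b c f C)
  define g :: "3 \<Rightarrow> real \<Rightarrow> real" where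
    "g i t = (if i = 1 then t ^ a else if i = 2 then t ^ b else (1 - t)\<^sup>2 * t ^ c)" for i t
  define I :: "3 \<Rightarrow> real" where
    "I i = (if i = 1 then \<Sum>j<k+1. \<xi> j ^ a * lam j else if i = 2 then \<Sum>j<k+1. \<xi> j ^ b * lam j
      else \<Sum>l<k+1. \<zeta> l ^ c * mu l)" for i
  have leg: "((\<lambda>t. t ^ d) has_integral (\<Sum>j<k+1. \<xi> j ^ d * lam j)) {0..1}" if "d \<le> 2 * k + 1" for d
    using that legendre degree_monom_le[of "1 :: real" d]
    unfolding gauss_legendre_def gauss_rule_def
    by (auto simp: poly_monom dest!: spec[of _ "monom 1 d"])
  have jac: "((\<lambda>t. (1 - t)\<^sup>2 * t ^ d) has_integral (\<Sum>l<k+1. \<zeta> l ^ d * mu l)) {0..1}"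
    if "d \<le> 2 * k + 1" for d
    using that jacobi degree_monom_le[of "1 :: real" d]
    unfolding gauss_jacobi_def gauss_rule_def
    by (auto simp: poly_monom dest!: spec[of _ "monom 1 d"])
  have "((\<lambda>p :: real^3. \<Prod>i\<in>UNIV. g i (p$i)) has_integral (\<Prod>i\<in>UNIV. I i)) (cbox 0 1)"
  proof (rule has_integral_cbox_prod)
    show "continuous_on UNIV (g i)" for i
      unfolding g_def using exhaust_3[of i] by (auto intro!: continuous_intros)
    show "0 \<le> g i t" if "t \<in> {0..1}" for i t
      using that by (auto simp: g_def)
    show "(g i has_integral I i) {0..1}" for i
      using leg[of a] leg[of b] jac[of c] monom.hyps exhaust_3[of i] unfolding g_def I_def by auto
  qed
  then have "((\<lambda>p. \<Prod>i\<in>UNIV. g i (p$i)) has_integral (\<Prod>i\<in>UNIV. I i)) duffy_cube"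
    by (rule has_integral_spike_set_eq[THEN iffD1, rotated 2])
       (auto intro: negligible_subset[OF negligible_top] simp: duffy_cube_eq_cbox_minus)
  then have int: "((\<lambda>p. (1 - p$3)\<^sup>2 * (p$1 ^ a * p$2 ^ b * p$3 ^ c)) has_integral I 1 * I 2 * I 3) duffy_cube"
    unfolding UNIV_3 by (simp add: g_def I_def algebra_simps)
  then have "(\<lambda>p. (1 - p$3)\<^sup>2 * (p$1 ^ a * p$2 ^ b * p$3 ^ c)) absolutely_integrable_on duffy_cube"
    by (intro nonnegative_absolutely_integrable_1) (auto simp: duffy_cube_def)
  then have "(\<lambda>p. C * ((1 - p$3)\<^sup>2 * (p$1 ^ a * p$2 ^ b * p$3 ^ c))) absolutely_integrable_on duffy_cube"
    by (rule set_integrable_mult_right)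
  moreover have eq: "C * ((1 - p$3)\<^sup>2 * (p$1 ^ a * p$2 ^ b * p$3 ^ c)) = (1 - p$3)\<^sup>2 * f p"
    if "p \<in> duffy_cube" for p
    using monom.hyps(4)[OF that] by simp
  moreover have "cube_quad k \<xi> lam \<zeta> mu f = C * (I 1 * I 2 * I 3)"
  proof -
    have "cube_quad k \<xi> lam \<zeta> mu f
        = cube_quad k \<xi> lam \<zeta> mu (\<lambda>p. C * (p$1 ^ a * p$2 ^ b * p$3 ^ c))"
      by (rule cube_quad_cong[OF legendre jacobi monom.hyps(4)])
    also have "\<dots> = C * (I 1 * I 2 * I 3)"
    proof -
      have "(\<Sum>i<n. \<Sum>j<n. \<Sum>l<n. C * (X i * (Y j * Z l))) = C * ((\<Sum>i<n. X i) * ((\<Sum>j<n. Y j) * (\<Sum>l<n. Z l)))"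
        for n and X Y Z :: "nat \<Rightarrow> real"
        by (simp flip: sum_distrib_left sum_distrib_right)
      from this[of "\<lambda>i. \<xi> i ^ a * lam i" "\<lambda>j. \<xi> j ^ b * lam j" "\<lambda>l. \<zeta> l ^ c * mu l" "k + 1"]
      show ?thesis
        by (simp add: cube_quad_def I_def mult_ac del: sum.lessThan_Suc)
    qed
    finally show ?thesis .
  qed
  moreover have "((\<lambda>p. C * ((1 - p$3)\<^sup>2 * (p$1 ^ a * p$2 ^ b * p$3 ^ c))) has_integral C * (I 1 * I 2 * I 3))
      duffy_cube"
    using int by (rule has_integral_mult_right)
  ultimately show ?case
    by (intro conjI set_integrable_cong[OF refl refl eq, THEN iffD1] has_integral_eq[OF eq])
       simp_all
next
  case (add f g h)
  have eq: "(1 - p$3)\<^sup>2 * f p + (1 - p$3)\<^sup>2 * g p = (1 - p$3)\<^sup>2 * h p" if "p \<in> duffy_cube" for p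
    using add.hyps(3)[OF that] by (simp add: algebra_simps)
  have "cube_quad k \<xi> lam \<zeta> mu h = cube_quad k \<xi> lam \<zeta> mu (\<lambda>p. f p + g p)"
    by (rule cube_quad_cong[OF legendre jacobi add.hyps(3)])
  also have "\<dots> = cube_quad k \<xi> lam \<zeta> mu f + cube_quad k \<xi> lam \<zeta> mu g"
    by (simp add: cube_quad_def sum.distrib algebra_simps del: sum.lessThan_Suc)
  finally have quad: "cube_quad k \<xi> lam \<zeta> mu h = cube_quad k \<xi> lam \<zeta> mu f + cube_quad k \<xi> lam \<zeta> mu g" .
  have "(\<lambda>p. (1 - p$3)\<^sup>2 * f p + (1 - p$3)\<^sup>2 * g p) absolutely_integrable_on duffy_cube"
    using add.IH by (intro set_integral_add(1)) auto
  moreover have "((\<lambda>p. (1 - p$3)\<^sup>2 * f p + (1 - p$3)\<^sup>2 * g p) has_integral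
      cube_quad k \<xi> lam \<zeta> mu h) duffy_cube"
    unfolding quad using add.IH by (intro has_integral_add) auto
  ultimately show ?case
    by (intro conjI set_integrable_cong[OF refl refl eq, THEN iffD1] has_integral_eq[OF eq])
       simp_all
qed


section \<open>The spaces on the infinite pyramid in cube coordinates\<close>

definition duffy :: "real^3 \<Rightarrow> real^3" where
  "duffy p = vector [p$1 * (1 - p$3), p$2 * (1 - p$3), p$3]"

text \<open>The point of the infinite pyramid that \<open>inf_map\<close> sends to \<open>duffy p\<close>.\<close>

definition inf_lift :: "real^3 \<Rightarrow> real^3" where
  "inf_lift p = vector [p$1, p$2, p$3 / (1 - p$3)]"

lemma inf_lift_nth [simp]:
  "inf_lift p $ 1 = p$1" "inf_lift p $ 2 = p$2" "inf_lift p $ 3 = p$3 / (1 - p$3)"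
  by (simp_all add: inf_lift_def)

lemma one_plus_inf_lift: "p \<in> duffy_cube \<Longrightarrow> 1 + p$3 / (1 - p$3) = 1 / (1 - p$3)"
  by (simp add: duffy_cube_def field_simps)

lemma inf_lift_in_inf_pyramid: "p \<in> duffy_cube \<Longrightarrow> inf_lift p \<in> inf_pyramid"
  by (simp add: duffy_cube_def inf_pyramid_def)

lemma inf_map_inf_lift: "p \<in> duffy_cube \<Longrightarrow> inf_map (inf_lift p) = duffy p"
  by (simp add: inf_map_def duffy_def one_plus_inf_lift) (simp add: duffy_cube_def)

text \<open>The rational functions of \<open>z\<close> in the spaces become polynomials in \<open>\<zeta>\<close>, because \<open>z = \<zeta> / (1 - \<zeta>)\<close> and
\<open>1 + z = 1 / (1 - \<zeta>)\<close>.  Division by \<open>(1 - \<zeta>)^e\<close> is the multiplication by \<open>(1 + z)^e\<close> that the change of frame brings in.\<close>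

lemma cube_poly_weight:
  assumes "j + e \<le> n"
  shows "cube_poly 0 0 (n - e) (\<lambda>p. (inf_lift p $ 3) ^ j / (1 + inf_lift p $ 3) ^ n / (1 - p$3) ^ e)"
proof -
  have "cube_poly 0 0 (n - e) (\<lambda>p. p$3 ^ j * (1 - p$3) ^ (n - e - j))"
  proof (rule cube_poly_mult)
    show "cube_poly 0 0 j (\<lambda>p. p$3 ^ j)"
      by (rule cube_poly.monom[of 0 _ 0 _ j _ _ 1]) auto
    show "cube_poly 0 0 (n - e - j) (\<lambda>p. (1 - p$3) ^ (n - e - j))"
      by (rule cube_poly_one_minus_z_power) simp
  qed (use assms in auto)
  then show ?thesis
  proof (rule cube_poly_cong)
    fix p assume p: "p \<in> duffy_cube"
    define t where "t = 1 - p$3"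
    have "t \<noteq> 0"
      using p by (simp add: t_def duffy_cube_def)
    moreover obtain r where "n = j + e + r"
      using assms le_Suc_ex by blast
    moreover have "1 + p$3 / t = 1 / t"
      using one_plus_inf_lift[OF p] by (simp add: t_def)
    ultimately show "(inf_lift p $ 3) ^ j / (1 + inf_lift p $ 3) ^ n / (1 - p$3) ^ e
        = p$3 ^ j * (1 - p$3) ^ (n - e - j)"
      by (simp flip: t_def) (simp add: power_add power_divide)
  qed
qed

lemma cube_poly_Q3:
  assumes q: "q \<in> Q3 l m n d" and l: "l \<le> int l'" and m: "m \<le> int m'"
    and n: "n + int e \<le> int d"
  shows "cube_poly l' m' (d - e) (\<lambda>p. q (inf_lift p) / (1 - p$3) ^ e)"
proof -
  obtain c where c: "q p = (\<Sum>a | int a \<le> l. \<Sum>b | int b \<le> m. \<Sum>j | int j \<le> n.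
        c a b j * (p$1 ^ a * p$2 ^ b * p$3 ^ j / (1 + p$3) ^ d))" for p
    using q by (auto simp: Q3_def)
  have fin: "finite {a. int a \<le> i}" for i
    by (rule finite_subset[of _ "{..nat i}"]) auto
  have "cube_poly l' m' (d - e) (\<lambda>p. \<Sum>a | int a \<le> l. \<Sum>b | int b \<le> m. \<Sum>j | int j \<le> n.
        (c a b j * (p$1 ^ a * p$2 ^ b * p$3 ^ 0)) *
        ((inf_lift p $ 3) ^ j / (1 + inf_lift p $ 3) ^ d / (1 - p$3) ^ e))"
  proof (intro cube_poly_sum fin, goal_cases)
    case (1 a b j)
    then show ?case
      using l m n
      by (intro cube_poly_mult[OF cube_poly.monom[of a l' b m' 0 0 _ "c a b j"] cube_poly_weight]) auto
  qed
  then show ?thesis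
    by (rule cube_poly_cong) (simp add: c sum_divide_distrib mult.assoc)
qed

lemma cube_poly_Q2: "r \<in> Q2 l m \<Longrightarrow> cube_poly l m 0 (\<lambda>p. r (p$1) (p$2))"
proof -
  assume "r \<in> Q2 l m"
  then obtain c where c: "r x y = (\<Sum>a\<le>l. \<Sum>b\<le>m. c a b * x ^ a * y ^ b)" for x y
    by (auto simp: Q2_def)
  have "cube_poly l m 0 (\<lambda>p. \<Sum>a\<le>l. \<Sum>b\<le>m. c a b * (p$1 ^ a * p$2 ^ b * p$3 ^ 0))"
    by (intro cube_poly_sum cube_poly.monom[OF _ _ _ refl]) auto
  then show ?thesis
    by (simp add: c mult.assoc)
qed

lemma cube_poly_dx:
  assumes "r \<in> Q2 l m"
  shows "cube_poly (l - 1) m 0 (\<lambda>p. dx r (p$1) (p$2))"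
proof -
  obtain c where c: "r x y = (\<Sum>a\<le>l. \<Sum>b\<le>m. c a b * x ^ a * y ^ b)" for x y
    using assms by (auto simp: Q2_def)
  have "((\<lambda>t. r t y) has_real_derivative
      (\<Sum>a\<le>l. \<Sum>b\<le>m. (c a b * a) * (x ^ (a - 1) * y ^ b * z ^ 0))) (at x)" for x y z
    unfolding c by (auto intro!: derivative_eq_intros sum.cong simp: mult_ac)
  then have "dx r (p$1) (p$2)
      = (\<Sum>a\<le>l. \<Sum>b\<le>m. (c a b * a) * (p$1 ^ (a - 1) * p$2 ^ b * p$3 ^ 0))" for p :: "real^3"
    unfolding dx_def by (intro DERIV_imp_deriv)
  note eq = this
  show ?thesis
    unfolding eq by (intro cube_poly_sum cube_poly.monom[OF _ _ _ refl]) auto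
qed

lemma cube_poly_dy:
  assumes "r \<in> Q2 l m"
  shows "cube_poly l (m - 1) 0 (\<lambda>p. dy r (p$1) (p$2))"
proof -
  obtain c where c: "r x y = (\<Sum>a\<le>l. \<Sum>b\<le>m. c a b * x ^ a * y ^ b)" for x y
    using assms by (auto simp: Q2_def)
  have "((\<lambda>t. r x t) has_real_derivative
      (\<Sum>a\<le>l. \<Sum>b\<le>m. (c a b * b) * (x ^ a * y ^ (b - 1) * z ^ 0))) (at y)" for x y z
    unfolding c by (auto intro!: derivative_eq_intros sum.cong simp: mult_ac)
  then have "dy r (p$1) (p$2)
      = (\<Sum>a\<le>l. \<Sum>b\<le>m. (c a b * b) * (p$1 ^ a * p$2 ^ (b - 1) * p$3 ^ 0))" for p :: "real^3"
    unfolding dy_def by (intro DERIV_imp_deriv)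
  note eq = this
  show ?thesis
    unfolding eq by (intro cube_poly_sum cube_poly.monom[OF _ _ _ refl]) auto
qed


section \<open>Alternating forms in three dimensions\<close>

lemma vector_3_expand: "v = v$1 *\<^sub>R e1 + v$2 *\<^sub>R e2 + v$3 *\<^sub>R e3" for v :: "real^3"
  by (simp add: vec_eq_iff forall_3 axis_def)

lemma alternating_form_map:
  assumes alt: "alternating_form s \<alpha>" and D: "linear D"
  shows "alternating_form s (\<lambda>vs. \<alpha> (map D vs))"
  unfolding alternating_form_def
proof (intro conjI allI impI)
  fix vs :: "(real^3) list" and i assume "length vs = s" "i < s"
  then have "linear (\<lambda>v. \<alpha> ((map D vs)[i := v]))"
    using alt by (simp add: alternating_form_def)
  from linear_compose[OF D this] show "linear (\<lambda>v. \<alpha> (map D (vs[i := v])))"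
    by (simp add: comp_def map_update)
next
  fix vs :: "(real^3) list" and i j assume "length vs = s" "i < j" "j < s" "vs ! i = vs ! j"
  moreover from this have "map D vs ! i = map D vs ! j"
    by simp
  ultimately show "\<alpha> (map D vs) = 0"
    using alt unfolding alternating_form_def by (metis length_map)
qed

lemma alternating_form_1_expand:
  assumes "alternating_form (Suc 0) \<beta>"
  shows "\<beta> [v] = v$1 * \<beta> [e1] + v$2 * \<beta> [e2] + v$3 * \<beta> [e3]"
proof -
  have "linear (\<lambda>v. \<beta> ([0][0 := v]))"
    using assms unfolding alternating_form_def by (metis One_nat_def length_Cons lessI list.size(3))
  then have lin: "linear (\<lambda>v. \<beta> [v])"
    by simp
  have "\<beta> [v] = \<beta> [v$1 *\<^sub>R e1 + v$2 *\<^sub>R e2 + v$3 *\<^sub>R e3]"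
    by (simp flip: vector_3_expand)
  then show ?thesis
    by (simp add: linear_add[OF lin] linear_cmul[OF lin])
qed

lemma alternating_form_2_expand:
  assumes alt: "alternating_form 2 \<beta>"
  shows "\<beta> [v, w] = (v$2 * w$3 - v$3 * w$2) * \<beta> [e2, e3] + (v$1 * w$3 - v$3 * w$1) * \<beta> [e1, e3]
    + (v$1 * w$2 - v$2 * w$1) * \<beta> [e1, e2]"
proof -
  have lin: "linear (\<lambda>a. \<beta> ([a0, b0][i := a]))" if "i < 2" for i a0 b0
    using alt that unfolding alternating_form_def by (metis length_Cons list.size(3) numeral_2_eq_2)
  have l1: "linear (\<lambda>a. \<beta> [a, b])" and l2: "linear (\<lambda>a. \<beta> [b, a])" for b
    using lin[of 0 0 b] lin[of 1 b 0] by simp_all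
  note lin_simps = linear_add[OF l1] linear_add[OF l2] linear_cmul[OF l1] linear_cmul[OF l2]
  have "\<beta> vs = 0" if "length vs = 2" "i < j" "j < 2" "vs ! i = vs ! j" for vs i j
    using alt that unfolding alternating_form_def by blast
  from this[of "[a, a]" 0 1 for a] have zero: "\<beta> [a, a] = 0" for a
    by simp
  have swap: "\<beta> [b, a] = - \<beta> [a, b]" for a b
    using zero[of "a + b"] unfolding lin_simps by (simp add: zero)
  have "\<beta> [v, w] = \<beta> [v$1 *\<^sub>R e1 + v$2 *\<^sub>R e2 + v$3 *\<^sub>R e3, w$1 *\<^sub>R e1 + w$2 *\<^sub>R e2 + w$3 *\<^sub>R e3]"
    by (simp flip: vector_3_expand)
  then show ?thesis
    by (simp add: lin_simps zero swap[of e2 e1] swap[of e3 e1] swap[of e3 e2] algebra_simps)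
qed

lemma alternating_form_3_expand:
  assumes alt: "alternating_form 3 \<beta>"
  shows "\<beta> [u, v, w] = (u$1 * (v$2 * w$3 - v$3 * w$2) - u$2 * (v$1 * w$3 - v$3 * w$1)
    + u$3 * (v$1 * w$2 - v$2 * w$1)) * \<beta> [e1, e2, e3]"
proof -
  have lin: "linear (\<lambda>a. \<beta> ([a0, b0, c0][i := a]))" if "i < 3" for i a0 b0 c0
    using alt that unfolding alternating_form_def by (metis length_Cons list.size(3) numeral_3_eq_3)
  have l1: "linear (\<lambda>a. \<beta> [a, b, c])" and l2: "linear (\<lambda>a. \<beta> [b, a, c])"
    and l3: "linear (\<lambda>a. \<beta> [b, c, a])" for b c
    using lin[of 0 0 b c] lin[of 1 b 0 c] lin[of 2 b c 0] by (simp_all add: numeral_2_eq_2)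
  note lin_simps = linear_add[OF l1] linear_add[OF l2] linear_add[OF l3]
    linear_cmul[OF l1] linear_cmul[OF l2] linear_cmul[OF l3]
  have eq0: "\<beta> vs = 0" if "length vs = 3" "i < j" "j < 3" "vs ! i = vs ! j" for vs i j
    using alt that unfolding alternating_form_def by blast
  have zero: "\<beta> [a, a, b] = 0" "\<beta> [a, b, a] = 0" "\<beta> [b, a, a] = 0" for a b
    using eq0[of "[a, a, b]" 0 1] eq0[of "[a, b, a]" 0 2] eq0[of "[b, a, a]" 1 2] by simp_all
  have swap12: "\<beta> [b, a, c] = - \<beta> [a, b, c]" for a b c
    using zero(1)[of "a + b" c] unfolding lin_simps by (simp add: zero)
  have swap23: "\<beta> [c, b, a] = - \<beta> [c, a, b]" for a b c
    using zero(3)[of c "a + b"] unfolding lin_simps by (simp add: zero)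
  have perms: "\<beta> [e2, e1, e3] = - \<beta> [e1, e2, e3]" "\<beta> [e1, e3, e2] = - \<beta> [e1, e2, e3]"
    "\<beta> [e2, e3, e1] = \<beta> [e1, e2, e3]" "\<beta> [e3, e1, e2] = \<beta> [e1, e2, e3]"
    "\<beta> [e3, e2, e1] = - \<beta> [e1, e2, e3]"
    using swap12[of e1 e2 e3] swap23[of e1 e2 e3] swap23[of e2 e1 e3] swap12[of e1 e3 e2]
      swap12[of e2 e3 e1] by simp_all
  have "\<beta> [u, v, w] = \<beta> [u$1 *\<^sub>R e1 + u$2 *\<^sub>R e2 + u$3 *\<^sub>R e3,
      v$1 *\<^sub>R e1 + v$2 *\<^sub>R e2 + v$3 *\<^sub>R e3, w$1 *\<^sub>R e1 + w$2 *\<^sub>R e2 + w$3 *\<^sub>R e3]"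
    by (simp flip: vector_3_expand)
  then show ?thesis
    by (simp add: lin_simps zero perms algebra_simps)
qed


section \<open>Components of a form on an affine pyramid\<close>

text \<open>The coordinates of the vector \<open>c\<close> with respect to the images of the standard basis under the derivative
of \<open>inf_map\<close> at \<open>inf_lift p\<close>; the powers of \<open>1 / (1 - \<zeta>)\<close> are the powers of \<open>1 + z\<close>.\<close>

definition frame_coeffs :: "real^3 \<Rightarrow> real^3 \<Rightarrow> real^3" where
  "frame_coeffs p c = vector [(c$1 + p$1 * c$3) / (1 - p$3), (c$2 + p$2 * c$3) / (1 - p$3),
     c$3 / (1 - p$3)\<^sup>2]"

definition inf_map_deriv :: "real^3 \<Rightarrow> real^3 \<Rightarrow> real^3" where
  "inf_map_deriv q v = vector [v$1 / (1 + q$3) - q$1 * v$3 / (1 + q$3)\<^sup>2,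
     v$2 / (1 + q$3) - q$2 * v$3 / (1 + q$3)\<^sup>2, v$3 / (1 + q$3)\<^sup>2]"

lemma vector_3_eq: "vector [a, b, c] = a *\<^sub>R axis 1 1 + b *\<^sub>R axis 2 1 + c *\<^sub>R (axis 3 1 :: real^3)"
  by (simp add: vec_eq_iff forall_3 axis_def)

lemma has_derivative_inf_map:
  assumes "q \<in> inf_pyramid"
  shows "(inf_map has_derivative inf_map_deriv q) (at q)"
proof -
  define t where "t = 1 + q$3"
  have t: "t \<noteq> 0"
    using assms by (auto simp: t_def inf_pyramid_def)
  have nth: "((\<lambda>p :: real^3. p$i) has_derivative (\<lambda>v. v$i)) (at q)" for i
    by (rule bounded_linear_imp_has_derivative[OF bounded_linear_vec_nth])
  have "((\<lambda>p. p$i / (1 + p$3)) has_derivative (\<lambda>v. (v$i * t - q$i * (0 + v$3)) / (t * t))) (at q)" for i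
    unfolding t_def by (intro has_derivative_divide' has_derivative_add has_derivative_const nth)
      (use t in \<open>simp add: t_def\<close>)
  moreover have "(v$i * t - q$i * (0 + v$3)) / (t * t) = v$i / t - q$i * v$3 / t\<^sup>2" for v :: "real^3" and i
    using t by (simp add: field_simps power2_eq_square)
  ultimately have comp: "((\<lambda>p. p$i / (1 + p$3)) has_derivative (\<lambda>v. v$i / t - q$i * v$3 / t\<^sup>2)) (at q)" for i
    by simp
  have "inf_map_deriv q = (\<lambda>v. (v$1 / t - q$1 * v$3 / t\<^sup>2) *\<^sub>R e1 + (v$2 / t - q$2 * v$3 / t\<^sup>2) *\<^sub>R e2
      + (v$3 / t - q$3 * v$3 / t\<^sup>2) *\<^sub>R e3)"
  proof
    fix v :: "real^3"
    have "v$3 / t\<^sup>2 = v$3 / t - q$3 * v$3 / t\<^sup>2"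
      using t by (simp add: field_simps power2_eq_square) (simp add: t_def algebra_simps)
    then show "inf_map_deriv q v = (v$1 / t - q$1 * v$3 / t\<^sup>2) *\<^sub>R e1 + (v$2 / t - q$2 * v$3 / t\<^sup>2) *\<^sub>R e2
      + (v$3 / t - q$3 * v$3 / t\<^sup>2) *\<^sub>R e3"
      by (simp only: inf_map_deriv_def vector_3_eq flip: t_def)
  qed
  then show ?thesis
    unfolding inf_map_def[abs_def] vector_3_eq
    by (auto intro!: has_derivative_add has_derivative_scaleR_left comp)
qed

lemma inf_map_deriv_frame_coeffs:
  assumes "p \<in> duffy_cube"
  shows "inf_map_deriv (inf_lift p) (frame_coeffs p c) = c"
proof -
  define t where "t = 1 - p$3"
  have "t \<noteq> 0" "1 + p$3 / t = 1 / t"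
    using assms one_plus_inf_lift[OF assms] by (auto simp: t_def duffy_cube_def)
  then show ?thesis
    by (simp add: inf_map_deriv_def frame_coeffs_def vec_eq_iff forall_3 flip: t_def)
       (simp add: field_simps power2_eq_square)
qed

lemma linear_inf_map_deriv: "linear (inf_map_deriv q)"
  by (rule linearI) (simp_all add: inf_map_deriv_def vec_eq_iff forall_3 add_divide_distrib algebra_simps)

lemma has_derivative_affine:
  fixes L :: "real^3 \<Rightarrow> real^3"
  assumes "linear L" "F = (\<lambda>x. L x + b)"
  shows "(F has_derivative L) (at x within S)"
  unfolding assms(2)
  using bounded_linear_imp_has_derivative[OF linear_conv_bounded_linear[THEN iffD1, OF assms(1)]]
  by (auto intro!: derivative_eq_intros)

lemma pullback_pyramid_map:
  assumes F: "linear L" "F = (\<lambda>x. L x + b)" and p: "p \<in> duffy_cube"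
  shows "pullback (F \<circ> inf_map) u (inf_lift p)
    = (\<lambda>vs. u (F (duffy p)) (map (L \<circ> inf_map_deriv (inf_lift p)) vs))"
proof -
  have "((F \<circ> inf_map) has_derivative (L \<circ> inf_map_deriv (inf_lift p))) (at (inf_lift p))"
    by (intro diff_chain_at has_derivative_inf_map inf_lift_in_inf_pyramid p has_derivative_affine[OF F])
  then have "frechet_derivative (F \<circ> inf_map) (at (inf_lift p)) = L \<circ> inf_map_deriv (inf_lift p)"
    by (simp add: frechet_derivative_at[symmetric])
  then show ?thesis
    by (simp add: pullback_def inf_map_inf_lift[OF p])
qed

text \<open>How the pulled back form, which the spaces describe, determines the original one on constant vectors.\<close>

lemma pullback_frame_coeffs:
  assumes F: "linear L" "F = (\<lambda>x. L x + b)" and p: "p \<in> duffy_cube"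
  shows "pullback (F \<circ> inf_map) u (inf_lift p) (map (frame_coeffs p) cs) = u (F (duffy p)) (map L cs)"
proof -
  have "(L \<circ> inf_map_deriv (inf_lift p)) \<circ> frame_coeffs p = L"
    by (simp add: fun_eq_iff inf_map_deriv_frame_coeffs[OF p])
  then show ?thesis
    by (simp add: pullback_pyramid_map[OF F p] flip: comp_assoc)
qed

text \<open>In the next four lemmas \<open>\<beta> p\<close> stands for the pulled back form at \<open>inf_lift p\<close>, and the arguments
\<open>frame_coeffs p c\<close> for constant vectors.\<close>

lemma cube_poly_Ubar0:
  assumes f: "f \<in> Ubar0 k"
    and \<beta>: "\<And>p. p \<in> duffy_cube \<Longrightarrow> proxy 0 (\<beta> p) = f (inf_lift p)"
  shows "cube_poly k k k (\<lambda>p. \<beta> p [])"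
proof -
  obtain q c where q: "q \<in> Q3 k k (int k - 1) k"
    and fq: "f p = [q p + c * (p$3 ^ k / (1 + p$3) ^ k)]" for p
    using f by (auto simp: Ubar0_def)
  have "cube_poly k k k (\<lambda>p. q (inf_lift p) / (1 - p$3) ^ 0
      + c * ((inf_lift p $ 3) ^ k / (1 + inf_lift p $ 3) ^ k / (1 - p$3) ^ 0))"
    by (intro cube_poly_add cube_poly_cmult)
       (use cube_poly_Q3[OF q, of k k 0] cube_poly_mono[OF cube_poly_weight[of k 0 k]] in auto)
  then show ?thesis
    by (rule cube_poly_cong) (use \<beta> in \<open>simp add: proxy_def fq\<close>)
qed

text \<open>Let \<open>f\<^sub>1\<close>, \<open>f\<^sub>2\<close>, \<open>f\<^sub>3\<close> be the components of the pulled back form.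
In \<open>(1+z) (c\<^sub>1 + c\<^sub>3 x) f\<^sub>1 + (1+z) (c\<^sub>2 + c\<^sub>3 y) f\<^sub>2 + (1+z)\<^sup>2 c\<^sub>3 f\<^sub>3\<close> the factor \<open>x\<close> raises the degree in
\<open>x\<close>, but \<open>f\<^sub>1\<close> has degree \<open>k - 1\<close> in \<open>x\<close>, the term with the derivative of \<open>r\<close> included; likewise for
\<open>y\<close> and \<open>f\<^sub>2\<close>.\<close>

lemma cube_poly_Ubar1:
  assumes f: "f \<in> Ubar1 k" and k: "k \<ge> 1"
    and \<beta>: "\<And>p. p \<in> duffy_cube \<Longrightarrow> alternating_form 1 (\<beta> p) \<and> proxy 1 (\<beta> p) = f (inf_lift p)"
  shows "cube_poly k k k (\<lambda>p. \<beta> p [frame_coeffs p c])"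
proof -
  obtain q1 q2 q3 r where q1: "q1 \<in> Q3 (int k - 1) k (int k - 1) (k + 1)"
    and q2: "q2 \<in> Q3 k (int k - 1) (int k - 1) (k + 1)"
    and q3: "q3 \<in> Q3 k k (int k - 2) (k + 1)"
    and r: "r \<in> Q2 k k"
    and fq: "\<And>p. let x = p$1; y = p$2; z = p$3; w = z ^ (k - 1) / (1 + z) ^ (k + 1) in
       f p = [q1 p + w * (dx r x y * z), q2 p + w * (dy r x y * z), q3 p + w * (- r x y)]"
    using f unfolding Ubar1_def by blast
  define w where "w j e p = (inf_lift p $ 3) ^ j / (1 + inf_lift p $ 3) ^ (k + 1) / (1 - p$3) ^ e"
    for j e p
  define g1 where "g1 p = q1 (inf_lift p) / (1 - p$3) ^ 1 + w k 1 p * dx r (p$1) (p$2)" for p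
  define g2 where "g2 p = q2 (inf_lift p) / (1 - p$3) ^ 1 + w k 1 p * dy r (p$1) (p$2)" for p
  define g3 where "g3 p = q3 (inf_lift p) / (1 - p$3) ^ 2 + w (k - 1) 2 p * (- 1 * r (p$1) (p$2))" for p
  have g1: "cube_poly (k - 1) k k g1"
    unfolding g1_def w_def
    by (intro cube_poly_add cube_poly_mult[OF cube_poly_weight cube_poly_dx[OF r]]
        cube_poly_mono[OF cube_poly_Q3[OF q1, of "k - 1" k]]) (use k in auto)
  have g2: "cube_poly k (k - 1) k g2"
    unfolding g2_def w_def
    by (intro cube_poly_add cube_poly_mult[OF cube_poly_weight cube_poly_dy[OF r]]
        cube_poly_mono[OF cube_poly_Q3[OF q2, of k "k - 1"]]) (use k in auto)
  have g3: "cube_poly k k k g3"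
    unfolding g3_def w_def
    by (intro cube_poly_add cube_poly_mult[OF cube_poly_weight cube_poly_cmult[OF cube_poly_Q2[OF r]]]
        cube_poly_mono[OF cube_poly_Q3[OF q3, of k k]]) (use k in auto)
  have "cube_poly k k k (\<lambda>p. (c$1 + c$3 * p$1) * g1 p + (c$2 + c$3 * p$2) * g2 p + c$3 * g3 p)"
  proof (intro cube_poly_add cube_poly_cmult)
    have "cube_poly 1 0 0 (\<lambda>p. c$1 + c$3 * p$1)"
      by (intro cube_poly_add cube_poly_cmult cube_poly_const cube_poly_x) simp
    then show "cube_poly k k k (\<lambda>p. (c$1 + c$3 * p$1) * g1 p)"
      by (rule cube_poly_mult[OF _ g1]) (use k in auto)
    have "cube_poly 0 1 0 (\<lambda>p. c$2 + c$3 * p$2)"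
      by (intro cube_poly_add cube_poly_cmult cube_poly_const cube_poly_y) simp
    then show "cube_poly k k k (\<lambda>p. (c$2 + c$3 * p$2) * g2 p)"
      by (rule cube_poly_mult[OF _ g2]) (use k in auto)
  qed (rule g3)
  then show ?thesis
  proof (rule cube_poly_cong)
    fix p assume p: "p \<in> duffy_cube"
    define t where "t = 1 - p$3"
    have t: "t \<noteq> 0"
      using p by (simp add: t_def duffy_cube_def)
    have zk: "z ^ k = z ^ (k - 1) * z" for z :: real
      using k by (cases k) auto
    have "\<beta> p [e1] = t * g1 p" "\<beta> p [e2] = t * g2 p" "\<beta> p [e3] = t\<^sup>2 * g3 p"
      using \<beta>[OF p] fq[of "inf_lift p"] t
      by (simp_all add: proxy_def Let_def g1_def g2_def g3_def w_def zk[of "_ / _"] distrib_left right_diff_distrib flip: t_def)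
    moreover have "alternating_form (Suc 0) (\<beta> p)"
      using \<beta>[OF p] by simp
    ultimately show "\<beta> p [frame_coeffs p c] =
        (c$1 + c$3 * p$1) * g1 p + (c$2 + c$3 * p$2) * g2 p + c$3 * g3 p"
      using t alternating_form_1_expand[of "\<beta> p" "frame_coeffs p c"]
      by (simp add: frame_coeffs_def flip: t_def) (simp add: algebra_simps)
  qed
qed


text \<open>The values on two constant vectors involve the \<open>2 \<times> 2\<close> minors of their coordinates.  In the minor that
multiplies the third component the terms with \<open>x y\<close> cancel, which leaves \<open>(1+z)\<^sup>2\<close> times a polynomial of
degree one in \<open>x\<close> and in \<open>y\<close>, and that component has degree \<open>k - 1\<close> in both.  The other two minors are
constant multiples of \<open>(1+z)\<^sup>3\<close>.\<close>

lemma cube_poly_Ubar2: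
  assumes f: "f \<in> Ubar2 k" and k: "k \<ge> 1"
    and \<beta>: "\<And>p. p \<in> duffy_cube \<Longrightarrow> alternating_form 2 (\<beta> p) \<and> proxy 2 (\<beta> p) = f (inf_lift p)"
  shows "cube_poly k k k (\<lambda>p. \<beta> p [frame_coeffs p c, frame_coeffs p d])"
proof -
  obtain q1 q2 q3 s r where q1: "q1 \<in> Q3 k (int k - 1) (int k - 2) (k + 2)"
    and q2: "q2 \<in> Q3 (int k - 1) k (int k - 2) (k + 2)"
    and q3: "q3 \<in> Q3 (int k - 1) (int k - 1) (int k - 1) (k + 2)"
    and s: "s \<in> Q2 (k - 1) k" and r: "r \<in> Q2 k (k - 1)"
    and fq: "\<And>p. let x = p$1; y = p$2; z = p$3; w = z ^ (k - 1) / (1 + z) ^ (k + 2) in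
       f p = [q1 p + w * (2 * r x y), q2 p + w * (2 * s x y),
              q3 p + w * (dy s x y * (1 + z)) + w * (dx r x y * (1 + z))]"
    using f unfolding Ubar2_def by blast
  define w where "w n e p = (inf_lift p $ 3) ^ (k - 1) / (1 + inf_lift p $ 3) ^ n / (1 - p$3) ^ e"
    for n e p
  define g1 where "g1 p = q1 (inf_lift p) / (1 - p$3) ^ 3 + w (k + 2) 3 p * (2 * r (p$1) (p$2))" for p
  define g2 where "g2 p = q2 (inf_lift p) / (1 - p$3) ^ 3 + w (k + 2) 3 p * (2 * s (p$1) (p$2))" for p
  define g3 where "g3 p = q3 (inf_lift p) / (1 - p$3) ^ 2
    + w (k + 1) 2 p * dy s (p$1) (p$2) + w (k + 1) 2 p * dx r (p$1) (p$2)" for p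
  have g1: "cube_poly k k k g1"
    unfolding g1_def w_def
    by (intro cube_poly_add cube_poly_mult[OF cube_poly_weight cube_poly_cmult[OF cube_poly_Q2[OF r]]]
        cube_poly_mono[OF cube_poly_Q3[OF q1, of k "k - 1"]]) (use k in auto)
  have g2: "cube_poly k k k g2"
    unfolding g2_def w_def
    by (intro cube_poly_add cube_poly_mult[OF cube_poly_weight cube_poly_cmult[OF cube_poly_Q2[OF s]]]
        cube_poly_mono[OF cube_poly_Q3[OF q2, of "k - 1" k]]) (use k in auto)
  have g3: "cube_poly (k - 1) (k - 1) k g3"
    unfolding g3_def w_def
    by (intro cube_poly_add cube_poly_mult[OF cube_poly_weight cube_poly_dx[OF r]]
        cube_poly_mult[OF cube_poly_weight cube_poly_dy[OF s]]
        cube_poly_mono[OF cube_poly_Q3[OF q3, of "k - 1" "k - 1"]]) (use k in auto)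
  (* the components of the cross product of c and d *)
  define M1 where "M1 = c$2 * d$3 - c$3 * d$2"
  define M2 where "M2 = c$3 * d$1 - c$1 * d$3"
  define M3 where "M3 = c$1 * d$2 - c$2 * d$1"
  have "cube_poly k k k (\<lambda>p. M1 * g1 p + M2 * g2 p + (M3 + (- M1) * p$1 + (- M2) * p$2) * g3 p)"
  proof (intro cube_poly_add cube_poly_cmult g1 g2)
    have "cube_poly 1 1 0 (\<lambda>p. M3 + (- M1) * p$1 + (- M2) * p$2)"
      by (intro cube_poly_add cube_poly_cmult cube_poly_const cube_poly_x cube_poly_y) simp_all
    then show "cube_poly k k k (\<lambda>p. (M3 + (- M1) * p$1 + (- M2) * p$2) * g3 p)"
      by (rule cube_poly_mult[OF _ g3]) (use k in auto)
  qed
  then show ?thesis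
  proof (rule cube_poly_cong)
    fix p assume p: "p \<in> duffy_cube"
    define t where "t = 1 - p$3"
    have t: "t \<noteq> 0"
      using p by (simp add: t_def duffy_cube_def)
    define Z where "Z = inf_lift p $ 3"
    define X where "X = Z ^ (k - 1) / (1 + Z) ^ (k + 2)"
    have Z: "1 + Z \<noteq> 0"
      using t one_plus_inf_lift[OF p] by (simp add: t_def Z_def)
    have w1: "X * b = t ^ 3 * (w (k + 2) 3 p * b)" for b
      using t by (simp add: w_def X_def del: inf_lift_nth flip: t_def Z_def)
    have w2: "X * (b * (1 + Z)) = t\<^sup>2 * (w (k + 1) 2 p * b)" for b
      using t Z by (simp add: w_def X_def del: inf_lift_nth flip: t_def Z_def)
    have "f (inf_lift p) = [q1 (inf_lift p) + X * (2 * r (p$1) (p$2)),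
        q2 (inf_lift p) + X * (2 * s (p$1) (p$2)),
        q3 (inf_lift p) + X * (dy s (p$1) (p$2) * (1 + Z)) + X * (dx r (p$1) (p$2) * (1 + Z))]"
      using fq[of "inf_lift p"] unfolding Let_def inf_lift_nth(1,2) Z_def[symmetric] X_def[symmetric] .
    also have "\<dots> = [t ^ 3 * g1 p, t ^ 3 * g2 p, t\<^sup>2 * g3 p]"
      unfolding w1[of "2 * r (p$1) (p$2)"] w1[of "2 * s (p$1) (p$2)"] w2
      using t by (simp add: g1_def g2_def g3_def distrib_left flip: t_def)
    finally have "\<beta> p [e2, e3] = t ^ 3 * g1 p" "\<beta> p [e1, e3] = - (t ^ 3 * g2 p)" "\<beta> p [e1, e2] = t\<^sup>2 * g3 p"
      using \<beta>[OF p] by (simp_all add: proxy_def)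
    moreover have "(a / t * (a' / t\<^sup>2) - b' / t\<^sup>2 * (b / t)) * (t ^ 3 * g) = (a * a' - b' * b) * g"
      "(a / t * (a' / t) - b' / t * (b / t)) * (t\<^sup>2 * g) = (a * a' - b' * b) * g" for a a' b b' g
      using t by (simp_all add: power2_eq_square power3_eq_cube field_simps)
    ultimately have "\<beta> p [frame_coeffs p c, frame_coeffs p d] =
        ((c$2 + p$2 * c$3) * d$3 - c$3 * (d$2 + p$2 * d$3)) * g1 p
        - ((c$1 + p$1 * c$3) * d$3 - c$3 * (d$1 + p$1 * d$3)) * g2 p
        + ((c$1 + p$1 * c$3) * (d$2 + p$2 * d$3) - (c$2 + p$2 * c$3) * (d$1 + p$1 * d$3)) * g3 p"
      using \<beta>[OF p] unfolding frame_coeffs_def t_def[symmetric]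
      by (simp only: alternating_form_2_expand[of "\<beta> p" "vector [_, _, _]" "vector [_, _, _]"] vector_3 minus_mult_right[symmetric] diff_conv_add_uminus[symmetric])
    also have "\<dots> = M1 * g1 p + M2 * g2 p + (M3 + (- M1) * p$1 + (- M2) * p$2) * g3 p"
      by (simp add: M1_def M2_def M3_def algebra_simps)
    finally show "\<beta> p [frame_coeffs p c, frame_coeffs p d] =
      M1 * g1 p + M2 * g2 p + (M3 + (- M1) * p$1 + (- M2) * p$2) * g3 p" .
  qed
qed

text \<open>The determinant of three coordinate vectors is the determinant of the vectors themselves times
\<open>(1+z)^4\<close>, since the matrix of \<open>frame_coeffs p\<close> is upper triangular.\<close>

lemma cube_poly_Ubar3:
  assumes f: "f \<in> Ubar3 k"
    and \<beta>: "\<And>p. p \<in> duffy_cube \<Longrightarrow> alternating_form 3 (\<beta> p) \<and> proxy 3 (\<beta> p) = f (inf_lift p)"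
  shows "cube_poly k k k (\<lambda>p. \<beta> p [frame_coeffs p b, frame_coeffs p c, frame_coeffs p d])"
proof -
  obtain q where q: "q \<in> Q3 (int k - 1) (int k - 1) (int k - 1) (k + 3)" and fq: "\<And>p. f p = [q p]"
    using f by (auto simp: Ubar3_def)
  define M where "M = b$1 * (c$2 * d$3 - c$3 * d$2) - b$2 * (c$1 * d$3 - c$3 * d$1)
    + b$3 * (c$1 * d$2 - c$2 * d$1)"
  have "cube_poly k k k (\<lambda>p. M * (q (inf_lift p) / (1 - p$3) ^ 4))"
    by (intro cube_poly_cmult cube_poly_mono[OF cube_poly_Q3[OF q, of k k 4]]) auto
  then show ?thesis
  proof (rule cube_poly_cong)
    fix p assume p: "p \<in> duffy_cube"
    define t where "t = 1 - p$3"
    have t: "t \<noteq> 0"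
      using p by (simp add: t_def duffy_cube_def)
    have "\<beta> p [e1, e2, e3] = q (inf_lift p)"
      using \<beta>[OF p] by (simp add: proxy_def fq)
    then have "\<beta> p [frame_coeffs p b, frame_coeffs p c, frame_coeffs p d] =
        ((b$1 + p$1 * b$3) / t * ((c$2 + p$2 * c$3) / t * (d$3 / t\<^sup>2) - c$3 / t\<^sup>2 * ((d$2 + p$2 * d$3) / t))
        - (b$2 + p$2 * b$3) / t * ((c$1 + p$1 * c$3) / t * (d$3 / t\<^sup>2) - c$3 / t\<^sup>2 * ((d$1 + p$1 * d$3) / t))
        + b$3 / t\<^sup>2 * ((c$1 + p$1 * c$3) / t * ((d$2 + p$2 * d$3) / t)
          - (c$2 + p$2 * c$3) / t * ((d$1 + p$1 * d$3) / t))) * q (inf_lift p)"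
      using \<beta>[OF p] alternating_form_3_expand[of "\<beta> p" "frame_coeffs p b" "frame_coeffs p c" "frame_coeffs p d"]
      by (simp add: frame_coeffs_def flip: t_def)
    also have "\<dots> = ((b$1 + p$1 * b$3) * ((c$2 + p$2 * c$3) * d$3 - c$3 * (d$2 + p$2 * d$3))
        - (b$2 + p$2 * b$3) * ((c$1 + p$1 * c$3) * d$3 - c$3 * (d$1 + p$1 * d$3))
        + b$3 * ((c$1 + p$1 * c$3) * (d$2 + p$2 * d$3) - (c$2 + p$2 * c$3) * (d$1 + p$1 * d$3)))
        * (q (inf_lift p) / t ^ 4)"
      by (simp add: power2_eq_square power4_eq_xxxx mult.assoc diff_divide_distrib[symmetric] add_divide_distrib[symmetric])
    also have "\<dots> = M * (q (inf_lift p) / t ^ 4)"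
      by (simp add: M_def algebra_simps)
    finally show "\<beta> p [frame_coeffs p b, frame_coeffs p c, frame_coeffs p d]
        = M * (q (inf_lift p) / (1 - p$3) ^ 4)"
      by (simp add: t_def)
  qed
qed

text \<open>Injectivity on the pyramid passes to the linear part because the pyramid has an interior point: a
kernel vector could be scaled down and added to that point without leaving the pyramid.\<close>

lemma affine_pyramidE:
  assumes "affine_pyramid F K"
  obtains L b where "linear L" "F = (\<lambda>x. L x + b)" "inj L" "F ` ref_pyramid = K"
proof -
  from assms obtain L b where L: "linear L" and F: "F = (\<lambda>x. L x + b)"
    and bij: "bij_betw F ref_pyramid K"
    unfolding affine_pyramid_def by blast
  have "v = 0" if "L v = 0" for v
  proof (rule ccontr)
    assume "v \<noteq> 0"
    (* a point at distance more than 1/8 from each face *)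
    define c :: "real^3" where "c = vector [1/4, 1/4, 1/4]"
    define w where "w = (1 / (8 * norm v)) *\<^sub>R v"
    have w: "\<bar>w$i\<bar> \<le> 1/8" for i
    proof -
      have "\<bar>w$i\<bar> \<le> norm w"
        by (rule component_le_norm_cart)
      also have "norm w = 1/8"
        using \<open>v \<noteq> 0\<close> by (simp add: w_def)
      finally show ?thesis .
    qed
    have "c \<in> ref_pyramid" "c + w \<in> ref_pyramid"
      using w[of 1] w[of 2] w[of 3] unfolding ref_pyramid_def c_def abs_le_iff by simp_all
    moreover have "F (c + w) = F c"
      using that by (simp add: F w_def linear_add[OF L] linear_cmul[OF L])
    ultimately have "c + w = c"
      using bij unfolding bij_betw_def by (meson inj_onD)
    then show False
      using \<open>v \<noteq> 0\<close> by (simp add: w_def)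
  qed
  then have "inj L"
    using L by (simp add: linear_injective_0)
  with L F bij show thesis
    by (intro that) (auto simp: bij_betw_def)
qed

lemma duffy_in_ref_pyramid: "p \<in> duffy_cube \<Longrightarrow> duffy p \<in> ref_pyramid"
  by (simp add: duffy_cube_def duffy_def ref_pyramid_def mult_left_le_one_le)

lemma cube_poly_pullback:
  assumes K: "affine_pyramid F K" and k: "k \<ge> 1" and s: "s \<le> 3"
    and u: "u \<in> Ubar_space s k F K" and vs: "length vs = s"
  shows "cube_poly k k k (\<lambda>p. u (F (duffy p)) vs)"
proof -
  from K obtain L b where L: "linear L" "inj L" and F: "F = (\<lambda>x. L x + b)" "F ` ref_pyramid = K"
    by (elim affine_pyramidE)
  from u obtain f where f: "f \<in> Ubar s k"
    and proxy: "\<And>q. q \<in> inf_pyramid \<Longrightarrow> proxy s (pullback (F \<circ> inf_map) u q) = f q"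
    unfolding Ubar_space_def by blast
  define \<beta> where "\<beta> p = pullback (F \<circ> inf_map) u (inf_lift p)" for p
  have alt: "alternating_form s (\<beta> p)" if "p \<in> duffy_cube" for p
  proof -
    have "F (duffy p) \<in> K"
      using duffy_in_ref_pyramid[OF that] F(2) by blast
    then have "alternating_form s (u (F (duffy p)))"
      using u by (simp add: Ubar_space_def smooth_forms_def)
    then show ?thesis
      unfolding \<beta>_def pullback_pyramid_map[OF L(1) F(1) that]
      by (intro alternating_form_map linear_compose linear_inf_map_deriv L)
  qed
  have \<beta>: "alternating_form s (\<beta> p) \<and> proxy s (\<beta> p) = f (inf_lift p)" if "p \<in> duffy_cube" for p
    using alt[OF that] proxy[OF inf_lift_in_inf_pyramid[OF that]] by (simp add: \<beta>_def)
  (* preimages of the arguments under L turn them into images of constant vectors *)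
  obtain L' where L': "L \<circ> L' = id"
    using linear_injective_imp_surjective[OF L] by (metis surj_iff)
  define cs where "cs = map L' vs"
  have "cube_poly k k k (\<lambda>p. \<beta> p (map (frame_coeffs p) cs))"
  proof -
    consider "s = 0" | "s = 1" | "s = 2" | "s = 3"
      using s by linarith
    then show ?thesis
    proof cases
      case 1
      then show ?thesis
        using cube_poly_Ubar0[of f k \<beta>] f \<beta> vs by (simp add: Ubar_def cs_def)
    next
      case 2
      then obtain c where "cs = [c]"
        using vs by (auto simp: cs_def length_Suc_conv)
      then show ?thesis
        using cube_poly_Ubar1[of f k \<beta> c] f \<beta> k 2 by (simp add: Ubar_def)
    next
      case 3
      then obtain c d where "cs = [c, d]"
        using vs by (auto simp: cs_def length_Suc_conv numeral_2_eq_2)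
      then show ?thesis
        using cube_poly_Ubar2[of f k \<beta> c d] f \<beta> k 3 by (simp add: Ubar_def)
    next
      case 4
      then obtain b c d where "cs = [b, c, d]"
        using vs by (auto simp: cs_def length_Suc_conv numeral_3_eq_3)
      then show ?thesis
        using cube_poly_Ubar3[of f k \<beta> b c d] f \<beta> 4 by (simp add: Ubar_def)
    qed
  qed
  then show ?thesis
  proof (rule cube_poly_cong)
    fix p assume p: "p \<in> duffy_cube"
    have "\<beta> p (map (frame_coeffs p) cs) = u (F (duffy p)) (map L cs)"
      unfolding \<beta>_def by (rule pullback_frame_coeffs[OF L(1) F(1) p])
    also have "map L cs = vs"
      by (simp add: cs_def L')
    finally show "u (F (duffy p)) vs = \<beta> p (map (frame_coeffs p) cs)" ..
  qed
qed

text \<open>The components on \<open>K\<close> are the values on the standard basis vectors, which are constant.\<close>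

lemma cube_poly_component:
  assumes "affine_pyramid F K" "k \<ge> 1" "s \<le> 3" "u \<in> Ubar_space s k F K" and i: "i \<in> comp_index s"
  shows "cube_poly k k k (\<lambda>p. component s u i (F (duffy p)))"
proof -
  note poly = cube_poly_pullback[OF assms(1-4)]
  consider "s = 0" "i = 1" | "s = 1" "i \<in> {1, 2, 3}" | "s = 2" "i \<in> {1, 2, 3}" | "s = 3" "i = 1"
  proof -
    have "s \<in> {0, 1, 2, 3}"
      using assms(3) by auto
    moreover have "i = 1 \<or> i = 2 \<or> i = 3" if "i \<in> {1..3}"
      using that by auto
    ultimately show thesis
      using i that by (auto simp: comp_index_def numeral_2_eq_2 numeral_3_eq_3)
  qed
  then show ?thesis
  proof cases
    case 1
    then show ?thesis
      using poly[of "[]"] by (simp add: component_def proxy_def)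
  next
    case 2
    then show ?thesis
      using poly[of "[e1]"] poly[of "[e2]"] poly[of "[e3]"] by (auto simp: component_def proxy_def)
  next
    case 3
    then show ?thesis
      using poly[of "[e2, e3]"] cube_poly_cmult[OF poly[of "[e1, e3]"], of "-1"] poly[of "[e1, e2]"]
      by (auto simp: component_def proxy_def)
  next
    case 4
    then show ?thesis
      using poly[of "[e1, e2, e3]"] by (simp add: component_def proxy_def)
  qed
qed


section \<open>Change of variables\<close>

lemma duffy_image: "duffy ` duffy_cube = ref_pyramid - {ref_apex}"
proof (intro subset_antisym subsetI)
  fix y assume "y \<in> duffy ` duffy_cube"
  then obtain p where p: "p \<in> duffy_cube" "y = duffy p"
    by blast
  moreover from p have "duffy p $ 3 \<noteq> ref_apex $ 3"
    by (simp add: duffy_def ref_apex_def duffy_cube_def)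
  ultimately show "y \<in> ref_pyramid - {ref_apex}"
    using duffy_in_ref_pyramid by auto
next
  fix y assume y: "y \<in> ref_pyramid - {ref_apex}"
  have "y $ 3 \<noteq> 1"
  proof
    assume "y $ 3 = 1"
    with y have "y = ref_apex"
      by (auto simp: ref_pyramid_def ref_apex_def vec_eq_iff forall_3)
    with y show False
      by simp
  qed
  with y have "y $ 3 < 1"
    by (simp add: ref_pyramid_def)
  define p :: "real^3" where "p = vector [y$1 / (1 - y$3), y$2 / (1 - y$3), y$3]"
  have "duffy p = y" "p \<in> duffy_cube"
    using y \<open>y $ 3 < 1\<close> by (simp_all add: p_def duffy_def duffy_cube_def ref_pyramid_def vec_eq_iff forall_3)
  then show "y \<in> duffy ` duffy_cube"
    by blast
qed

lemma inj_on_duffy: "inj_on duffy duffy_cube"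
  by (rule inj_onI) (auto simp: duffy_def duffy_cube_def vec_eq_iff forall_3)

definition duffy_deriv :: "real^3 \<Rightarrow> real^3 \<Rightarrow> real^3" where
  "duffy_deriv p v = vector [v$1 * (1 - p$3) - p$1 * v$3, v$2 * (1 - p$3) - p$2 * v$3, v$3]"

lemma has_derivative_duffy: "(duffy has_derivative duffy_deriv p) (at p within S)"
proof -
  have nth: "((\<lambda>p :: real^3. p$i) has_derivative (\<lambda>v. v$i)) (at p within S)" for i
    by (rule bounded_linear_imp_has_derivative[OF bounded_linear_vec_nth])
  show ?thesis
    unfolding duffy_def[abs_def] vector_3_eq
    by (rule derivative_eq_intros nth refl)+
       (simp add: fun_eq_iff duffy_deriv_def vector_3_eq algebra_simps)
qed

lemma linear_duffy_deriv: "linear (duffy_deriv p)"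
  by (rule linearI) (simp_all add: duffy_deriv_def vec_eq_iff forall_3 algebra_simps)

lemma det_duffy_deriv: "det (matrix (duffy_deriv p)) = (1 - p$3)\<^sup>2"
  by (simp add: det_3 matrix_def duffy_deriv_def axis_def power2_eq_square)

lemma duffy_cube_lebesgue: "duffy_cube \<in> sets lebesgue"
  unfolding duffy_cube_eq_cbox_minus
  by (intro sets.Diff negligible_imp_sets[OF negligible_top]) simp

text \<open>The change of variables theorem for vector-valued functions, read off for scalar ones through
one-dimensional vectors.\<close>

lemma has_absolute_integral_change_of_variables_scalar:
  fixes f :: "real^'m::{finite,wellorder} \<Rightarrow> real" and g :: "real^'m::_ \<Rightarrow> real^'m::_"
  assumes "S \<in> sets lebesgue"
    and "\<And>x. x \<in> S \<Longrightarrow> (g has_derivative g' x) (at x within S)"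
    and "inj_on g S"
  shows "(\<lambda>x. \<bar>det (matrix (g' x))\<bar> * f (g x)) absolutely_integrable_on S \<and>
      integral S (\<lambda>x. \<bar>det (matrix (g' x))\<bar> * f (g x)) = b
    \<longleftrightarrow> f absolutely_integrable_on (g ` S) \<and> integral (g ` S) f = b"
  using has_absolute_integral_change_of_variables[OF assms, of "\<lambda>x. vec (f x) :: real^1" "vec b"]
  by (simp add: absolutely_integrable_on_1_iff integral_on_1_eq)

text \<open>The image of the cube misses only the apex of \<open>K\<close>, which is a null set.\<close>

lemma pyramid_change_of_variables:
  assumes L: "linear L" "inj L" and F: "F = (\<lambda>x. L x + b)" "F ` ref_pyramid = K"
    and abs: "(\<lambda>p. (1 - p$3)\<^sup>2 * f (F (duffy p))) absolutely_integrable_on duffy_cube"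
    and int: "((\<lambda>p. (1 - p$3)\<^sup>2 * f (F (duffy p))) has_integral I) duffy_cube"
  shows "f absolutely_integrable_on K" "integral K f = \<bar>det (matrix L)\<bar> * I"
proof -
  have inj_F: "inj F"
    using L(2) by (simp add: F inj_def)
  have det: "\<bar>det (matrix (L \<circ> duffy_deriv p))\<bar> * f ((F \<circ> duffy) p)
      = \<bar>det (matrix L)\<bar> * ((1 - p$3)\<^sup>2 * f (F (duffy p)))" for p
    by (simp add: matrix_compose[OF linear_duffy_deriv L(1)] det_mul det_duffy_deriv abs_mult)
  have "f absolutely_integrable_on (F \<circ> duffy) ` duffy_cube \<and>
      integral ((F \<circ> duffy) ` duffy_cube) f = \<bar>det (matrix L)\<bar> * I"
  proof (subst has_absolute_integral_change_of_variables_scalar[symmetric])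
    show "((F \<circ> duffy) has_derivative L \<circ> duffy_deriv p) (at p within duffy_cube)" for p
      by (rule diff_chain_within[OF has_derivative_duffy has_derivative_affine[OF L(1) F(1)]])
    show "inj_on (F \<circ> duffy) duffy_cube"
      by (intro comp_inj_on inj_on_duffy inj_on_subset[OF inj_F]) simp
    show "(\<lambda>p. \<bar>det (matrix (L \<circ> duffy_deriv p))\<bar> * f ((F \<circ> duffy) p)) absolutely_integrable_on duffy_cube \<and>
      integral duffy_cube (\<lambda>p. \<bar>det (matrix (L \<circ> duffy_deriv p))\<bar> * f ((F \<circ> duffy) p)) = \<bar>det (matrix L)\<bar> * I"
      unfolding det using set_integrable_mult_right[OF abs, of "\<bar>det (matrix L)\<bar>"] integral_unique[OF int]
      by simp
  qed (rule duffy_cube_lebesgue)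
  moreover have "(F \<circ> duffy) ` duffy_cube = K - {F ref_apex}"
    unfolding image_comp[symmetric] duffy_image image_set_diff[OF inj_F] F(2) by simp
  ultimately have *: "f absolutely_integrable_on K - {F ref_apex}"
    "integral (K - {F ref_apex}) f = \<bar>det (matrix L)\<bar> * I"
    by simp_all
  have n: "negligible {x \<in> K - {F ref_apex} - K. f x \<noteq> 0}" "negligible {x \<in> K - (K - {F ref_apex}). f x \<noteq> 0}"
    by (auto intro: negligible_subset[of "{F ref_apex}"])
  show "f absolutely_integrable_on K"
    using *(1) by (rule absolutely_integrable_spike_set_eq[OF n, THEN iffD1])
  show "integral K f = \<bar>det (matrix L)\<bar> * I"
    using *(2) integral_spike_set[OF n] by simp
qed

lemma abs_jacobian_affine:
  assumes "linear L" "F = (\<lambda>x. L x + b)"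
  shows "abs_jacobian F x = \<bar>det (matrix L)\<bar>"
  by (simp add: abs_jacobian_def frechet_derivative_at[OF has_derivative_affine[OF assms], symmetric])

lemma quad_affine_pyramid:
  assumes "linear L" "F = (\<lambda>x. L x + b)"
  shows "quad k \<xi> lam \<zeta> mu F f = \<bar>det (matrix L)\<bar> * cube_quad k \<xi> lam \<zeta> mu (\<lambda>p. f (F (duffy p)))"
  by (simp add: quad_def quad_ref_def cube_quad_def abs_jacobian_affine[OF assms] duffy_def
      sum_distrib_left mult_ac del: sum.lessThan_Suc)


section \<open>Exactness of the quadrature\<close>

theorem theorem2:
  fixes \<phi>K :: "real^3 \<Rightarrow> real^3" and K :: "(real^3) set"
    and k s :: nat
    and A :: tensor_field
    and u v :: form_field
    and \<xi> lam \<zeta> mu :: "nat \<Rightarrow> real"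
  assumes "affine_pyramid \<phi>K K"
    and "k \<ge> 1"
    and "s \<in> {0, 1, 2, 3}"
    and "constant_tensor s K A"
    and "gauss_legendre (k + 1) \<xi> lam"
    and "gauss_jacobi (k + 1) \<zeta> mu"
    and "u \<in> U_space s k \<phi>K K"
    and "v \<in> U_space s k \<phi>K K"
  shows "set_integrable lebesgue K (tensor_apply s A u v) \<and>
         quad k \<xi> lam \<zeta> mu \<phi>K (tensor_apply s A u v) = tensor_inner s A K u v"
proof -
  from assms(1) obtain L b where L: "linear L" "inj L"
    and F: "\<phi>K = (\<lambda>x. L x + b)" "\<phi>K ` ref_pyramid = K"
    by (elim affine_pyramidE)
  have s: "s \<le> 3"
    using assms(3) by auto
  have u: "u \<in> Ubar_space s k \<phi>K K" and v: "v \<in> Ubar_space s k \<phi>K K"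
    using assms(7,8) by (simp_all add: U_space_def)
  obtain a where a: "A i j x = a i j" if "i \<in> comp_index s" "j \<in> comp_index s" "x \<in> K" for i j x
    using assms(4) unfolding constant_tensor_def constant_on_def by metis
  define g where "g = (\<lambda>p. tensor_apply s A u v (\<phi>K (duffy p)))"
  have fin: "finite (comp_index s)"
    by (simp add: comp_index_def)
  have "cube_poly (2 * k + 1) (2 * k + 1) (2 * k + 1) (\<lambda>p. \<Sum>i\<in>comp_index s. \<Sum>j\<in>comp_index s.
      a i j * component s u i (\<phi>K (duffy p)) * component s v j (\<phi>K (duffy p)))"
    by (intro cube_poly_sum fin
        cube_poly_mult[OF cube_poly_cmult[OF cube_poly_component[OF assms(1,2) s u]]
          cube_poly_component[OF assms(1,2) s v]]) auto
  then have "cube_poly (2 * k + 1) (2 * k + 1) (2 * k + 1) g"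
  proof (rule cube_poly_cong)
    fix p assume "p \<in> duffy_cube"
    then have "\<phi>K (duffy p) \<in> K"
      using duffy_in_ref_pyramid F(2) by blast
    then show "g p = (\<Sum>i\<in>comp_index s. \<Sum>j\<in>comp_index s.
        a i j * component s u i (\<phi>K (duffy p)) * component s v j (\<phi>K (duffy p)))"
      by (simp add: g_def tensor_apply_def a)
  qed
  from cube_gauss_exact[OF assms(5,6) this]
  have "tensor_apply s A u v absolutely_integrable_on K"
    "integral K (tensor_apply s A u v) = \<bar>det (matrix L)\<bar> * cube_quad k \<xi> lam \<zeta> mu g"
    unfolding g_def by (auto intro: pyramid_change_of_variables[OF L F])
  then show ?thesis
    using quad_affine_pyramid[OF L(1) F(1), of k \<xi> lam \<zeta> mu "tensor_apply s A u v"]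
    by (simp add: tensor_inner_def set_lebesgue_integral_eq_integral g_def)
qed

end
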